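(* Let $S_1:X\rightrightarrows Y$ and $S_2:Y\rightrightarrows Z$ be multifunctions between reflexive Banach spaces, and let $\Omega\subset X$ and $\Theta\subset Z$ be closed and convex. Consider the composition $S:=S_2\circ S_1:X\rightrightarrows Z$ and define $G:X\times Z\rightrightarrows Y$ by $$G(x,z):=S_1(x)\cap S_2^{-1}(z)=\{y\in S_1(x): z\in S_2(y)\},\quad x\in X,\ z\in Z.$$ Fix $(\bar x,\bar z)\in\operatorname{gph}S|_\Omega^\Theta$ and $\bar y\in G(\bar x,\bar z)$, and suppose that $\operatorname{gph}S_1|_\Omega$ and $\operatorname{gph}S_2|^\Theta$ are closed around $(\bar x,\bar y)$ and $(\bar y,\bar z)$, respectively, and that $G$ is inner semicontinuous relative to $\Omega\times\Theta$ at $(\bar x,\bar z,\bar y)$. Then the following hold: (i) Assume that either $S_1$ is mirror PSNC relative to $\Omega\times Y$ at $(\bar x,\bar y)$ or $S_2$ is PSNC relative to $Y\times\Theta$ at $(\bar y,\bar z)$, and that the mixed qualification condition $$\ker D_m^*S_{1\Omega}(\bar x|\bar y)\cap D_M^*S_2^\Theta(\bar y|\bar z)(0)=\{0\}$$ is satisfied. Then for all $z^*\in Z^*$ we have the inclusions $$D_M^*S_\Omega^\Theta(\bar x|\bar z)(z^* )\subset D_N^*S_{1\Omega}(\bar x|\bar y)\circ D_M^*S_2^\Theta(\bar y|\bar z)(z^* ),$$ $$D_N^*S_\Omega^\Theta(\bar x|\bar z)(z^* )\subset D_N^*S_{1\Omega}(\bar x|\bar y)\circ D_N^*S_2^\Theta(\bar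 y|\bar z)(z^* ).$$ (ii) If $\Theta=Z$ and $S_2:=f:Y\to Z$ is single-valued and strictly differentiable at $\bar y$, then $$D_M^*S_\Omega(\bar x|\bar z)(z^* )\subset D_M^*S_{1\Omega}(\bar x|\bar y)\big(\nabla f(\bar y)^*z^*\big)\quad\text{for all }z^*\in Z^*.$$
   Context: Conventions. "Reflexive Banach space" means a reflexive Banach space normed in such a way that both $X$ and $X^*$ are locally uniformly convex. $\rightharpoonup^*$ is weak$^*$ convergence; products of Banach spaces carry the Euclidean product norm, e.g. $\|(x,y)\|=\sqrt{\|x\|^2+\|y\|^2}$. A set is closed around one of its points $\bar u$ if its intersection with some closed set containing $\bar u$ in its interior is closed. For a multifunction $S:X\rightrightarrows Y$, $\Omega\subset X$, $\Theta\subset Y$: $\operatorname{gph}S=\{(x,y): y\in S(x)\}$; $S|_\Omega^\Theta(x)=S(x)\cap\Theta$ if $x\in\Omega$ and $\emptyset$ otherwise; $S|_\Omega=S|_\Omega^Y$; $S|^\Theta=S|_X^\Theta$. $\ker H=\{u: 0\in H(u)\}$. Composition: $(H_1\circ H_2)(u)=\bigcup_{v\in H_2(u)}H_1(v)$. Duality mapping: $J_X(x)=\{x^*: \langle x^*,x\rangle=\|x\|^2,\ \|x^*\|=\|x\|\}$; for a set $A$, $J_X(A)=\bigcup_{x\in A}J_X(x)$. Contingent cone at $\bar x\in\Omega$: $T(\bar x;\Omega)=\{z: \exists\, t_k\downarrow0,\ z_k\to z,\ \bar x+t_kz_k\in\Omega\}$. $\varepsilon$-normals at $\bar x\in\Omega$: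 $\widehat N_\varepsilon(\bar x;\Omega)=\{x^*: \limsup_{x\to\bar x,\,x\in\Omega}\langle x^*,x-\bar x\rangle/\|x-\bar x\|\le\varepsilon\}$. Relative contingent coderivatives. For $S:X\rightrightarrows Y$ and $(\bar x,\bar y)\in\operatorname{gph}S|_\Omega^\Theta$, consider sequences $\varepsilon_k\downarrow0$, $(x_k,y_k)\to(\bar x,\bar y)$ with $(x_k,y_k)\in\operatorname{gph}S|_\Omega^\Theta$, and $(x_k^*,y_k^* )$ with $$(x_k^*,-y_k^* )\in\widehat N_{\varepsilon_k}\big((x_k,y_k);\operatorname{gph}S|_\Omega^\Theta\big)\cap\big[J_X(T(x_k;\Omega))\times J_Y(T(y_k;\Theta))\big]\quad\text{for all }k.\qquad( * )$$ $\bar x^*\in D_N^*S_\Omega^\Theta(\bar x|\bar y)(\bar y^* )$ (normal) iff there are such sequences with $x_k^*\rightharpoonup^*\bar x^*$, $y_k^*\rightharpoonup^*\bar y^*$; $\bar x^*\in D_M^*S_\Omega^\Theta(\bar x|\bar y)(\bar y^* )$ (mixed) iff there are such sequences with $x_k^*\rightharpoonup^*\bar x^*$, $y_k^*\to\bar y^*$ in norm; $\bar x^*\in D_m^*S_\Omega^\Theta(\bar x|\bar y)(\bar y^* )$ (mirror) iff there are such sequences with $x_k^*\to\bar x^*$ in norm, $y_k^*\rightharpoonup^*\bar y^*$. The superscript $\Theta$ is dropped when $\Theta$ is the whole image space and the subscript $\Omega$ is dropped when $\Omega$ is the whole domain space; $D^*S_{1\Omega}$ means $D^*(S_1)_\Omega$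 (relative to $\Omega\times Y$) and $D^*S_2^\Theta$ means $D^*(S_2)^\Theta$ (relative to $Y\times\Theta$). PSNC: $S$ is PSNC relative to $\Omega\times\Theta$ at $(\bar x,\bar y)\in\operatorname{gph}S|_\Omega^\Theta$ if for all sequences $\varepsilon_k\in(0,1)$, $\varepsilon_k\downarrow 0$, $\operatorname{gph}S|_\Omega^\Theta\ni(x_k,y_k)\to(\bar x,\bar y)$, $(x_k^*,y_k^* )$ satisfying $( * )$ with $x_k^*\rightharpoonup^*0$, $y_k^*\to0$, one has $\|x_k^*\|\to0$. Mirror PSNC: the same with $x_k^*\to0$, $y_k^*\rightharpoonup^*0$, and conclusion $\|y_k^*\|\to0$. Inner semicontinuity: $F:U\rightrightarrows V$ is inner semicontinuous relative to $A\subset U$ at $(\bar u,\bar v)\in\operatorname{gph}F|_A$ if for every sequence $u_k\to\bar u$ with $u_k\in\operatorname{dom}F\cap A$ (where $\operatorname{dom}F=\{u:F(u)\ne\emptyset\}$) there are $v_k\in F(u_k)$ converging to $\bar v$. Here it is applied to $F=G$, $U=X\times Z$, $A=\Omega\times\Theta$. $f$ is strictly differentiable at $\bar y$ with strict derivative $\nabla f(\bar y)$ (a bounded linear operator) if $\lim_{(y,u)\to(\bar y,\bar y)}\frac{f(y)-f(u)-\nabla f(\bar y)(y-u)}{\|y-u\|}=0$; $\nabla f(\bar y)^*$ is the adjoint. *)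

theory Defs
  imports "HOL-Analysis.Analysis"
begin

definition reflexive_space :: "'a::real_normed_vector itself \<Rightarrow> bool" where
  "reflexive_space (_ :: 'a itself) \<longleftrightarrow>
     (\<forall>\<phi> :: ('a \<Rightarrow>\<^sub>L real) \<Rightarrow>\<^sub>L real. \<exists>x::'a. \<forall>xs. blinfun_apply \<phi> xs = blinfun_apply xs x)"

definition locally_uniformly_convex :: "'a::real_normed_vector itself \<Rightarrow> bool" where
  "locally_uniformly_convex (_ :: 'a itself) \<longleftrightarrow>
     (\<forall>(x::'a) u. norm x = 1 \<and> (\<forall>n. norm (u n) = 1) \<and> (\<lambda>n::nat. norm (x + u n)) \<longlonglongrightarrow> 2
        \<longrightarrow> u \<longlonglongrightarrow> x)"

text \<open>
  Following the standing convention, a reflexive Banach space carries a norm for which both the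
  space and its dual are locally uniformly convex. Completeness comes from the class
  \<open>banach\<close>.
\<close>

definition lur_reflexive :: "'a::banach itself \<Rightarrow> bool" where
  "lur_reflexive (_ :: 'a itself) \<longleftrightarrow>
     reflexive_space TYPE('a) \<and> locally_uniformly_convex TYPE('a) \<and>
     locally_uniformly_convex TYPE('a \<Rightarrow>\<^sub>L real)"

definition weak_star_tendsto ::
    "(nat \<Rightarrow> 'a::real_normed_vector \<Rightarrow>\<^sub>L real) \<Rightarrow> ('a \<Rightarrow>\<^sub>L real) \<Rightarrow> bool" where
  "weak_star_tendsto xs l \<longleftrightarrow> (\<forall>x. (\<lambda>k. blinfun_apply (xs k) x) \<longlonglongrightarrow> blinfun_apply l x)"

text \<open>
  The functional \<open>(x, y) \<mapsto> \<langle>xs, x\<rangle> + \<langle>ys, y\<rangle>\<close> on a product represents the pair \<open>(xs, ys)\<close>.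
  The norm of \<open>'a \<times> 'b\<close> in the library is the Euclidean product norm.
\<close>

definition dual_pair ::
    "('a::real_normed_vector \<Rightarrow>\<^sub>L real) \<Rightarrow> ('b::real_normed_vector \<Rightarrow>\<^sub>L real) \<Rightarrow> ('a \<times> 'b) \<Rightarrow>\<^sub>L real" where
  "dual_pair xs ys = (xs o\<^sub>L fst_blinfun) + (ys o\<^sub>L snd_blinfun)"

text \<open>
  Here \<open>t \<down> 0\<close> means positive terms converging to 0. Monotonicity is not required; since one may
  always pass to subsequences, demanding it would not change any of the notions below.
\<close>

definition down_to_zero :: "(nat \<Rightarrow> real) \<Rightarrow> bool" where
  "down_to_zero t \<longleftrightarrow> (\<forall>k. 0 < t k) \<and> t \<longlonglongrightarrow> 0"

definition gph :: "('a \<Rightarrow> 'b set) \<Rightarrow> ('a \<times> 'b) set" where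
  "gph S = {(x, y). y \<in> S x}"

definition mrestrict :: "('a \<Rightarrow> 'b set) \<Rightarrow> 'a set \<Rightarrow> 'b set \<Rightarrow> 'a \<Rightarrow> 'b set" where
  "mrestrict S \<Omega> \<Theta> x = (if x \<in> \<Omega> then S x \<inter> \<Theta> else {})"

definition mdom :: "('a \<Rightarrow> 'b set) \<Rightarrow> 'a set" where
  "mdom S = {x. S x \<noteq> {}}"

definition mker :: "('a \<Rightarrow> 'b::zero set) \<Rightarrow> 'a set" where
  "mker H = {u. 0 \<in> H u}"

definition mcomp :: "('b \<Rightarrow> 'c set) \<Rightarrow> ('a \<Rightarrow> 'b set) \<Rightarrow> 'a \<Rightarrow> 'c set" where
  "mcomp H1 H2 u = (\<Union>v\<in>H2 u. H1 v)"

definition closed_around :: "'a::topological_space set \<Rightarrow> 'a \<Rightarrow> bool" where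
  "closed_around A u \<longleftrightarrow> u \<in> A \<and> (\<exists>C. closed C \<and> u \<in> interior C \<and> closed (A \<inter> C))"

definition inner_semicontinuous ::
    "('a::topological_space \<Rightarrow> 'b::topological_space set) \<Rightarrow> 'a set \<Rightarrow> 'a \<Rightarrow> 'b \<Rightarrow> bool" where
  "inner_semicontinuous F A u v \<longleftrightarrow>
     (u, v) \<in> gph (mrestrict F A UNIV) \<and>
     (\<forall>us :: nat \<Rightarrow> 'a. (\<forall>k. us k \<in> mdom F \<inter> A) \<and> us \<longlonglongrightarrow> u \<longrightarrow>
        (\<exists>vs. (\<forall>k. vs k \<in> F (us k)) \<and> vs \<longlonglongrightarrow> v))"

definition duality_map :: "'a::real_normed_vector \<Rightarrow> ('a \<Rightarrow>\<^sub>L real) set" where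
  "duality_map x = {xs. blinfun_apply xs x = (norm x)\<^sup>2 \<and> norm xs = norm x}"

definition contingent_cone :: "'a::real_normed_vector \<Rightarrow> 'a set \<Rightarrow> 'a set" where
  "contingent_cone x \<Omega> =
     {z. \<exists>t zs. down_to_zero t \<and> zs \<longlonglongrightarrow> z \<and> (\<forall>k. x + t k *\<^sub>R zs k \<in> \<Omega>)}"

definition duality_image :: "'a::real_normed_vector set \<Rightarrow> ('a \<Rightarrow>\<^sub>L real) set" where
  "duality_image A = (\<Union>x\<in>A. duality_map x)"

text \<open>
  If \<open>x\<close> is an isolated point of \<open>\<Omega>\<close>, the filter is trivial, the upper limit is \<open>-\<infinity>\<close> and every
  functional is an \<open>\<epsilon>\<close>-normal.
\<close>

definition eps_normals :: "real \<Rightarrow> 'a::real_normed_vector \<Rightarrow> 'a set \<Rightarrow> ('a \<Rightarrow>\<^sub>L real) set" where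
  "eps_normals \<epsilon> x \<Omega> =
     {xs. Limsup (at x within \<Omega>) (\<lambda>u. ereal (blinfun_apply xs (u - x) / norm (u - x))) \<le> ereal \<epsilon>}"

definition coderiv_seq ::
    "('a::real_normed_vector \<Rightarrow> 'b::real_normed_vector set) \<Rightarrow> 'a set \<Rightarrow> 'b set \<Rightarrow> 'a \<Rightarrow> 'b \<Rightarrow>
     (nat \<Rightarrow> real) \<Rightarrow> (nat \<Rightarrow> 'a) \<Rightarrow> (nat \<Rightarrow> 'b) \<Rightarrow>
     (nat \<Rightarrow> 'a \<Rightarrow>\<^sub>L real) \<Rightarrow> (nat \<Rightarrow> 'b \<Rightarrow>\<^sub>L real) \<Rightarrow> bool" where
  "coderiv_seq S \<Omega> \<Theta> x y \<epsilon> xk yk xsk ysk \<longleftrightarrow>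
     down_to_zero \<epsilon> \<and> xk \<longlonglongrightarrow> x \<and> yk \<longlonglongrightarrow> y \<and>
     (\<forall>k. (xk k, yk k) \<in> gph (mrestrict S \<Omega> \<Theta>)) \<and>
     (\<forall>k. dual_pair (xsk k) (- ysk k) \<in> eps_normals (\<epsilon> k) (xk k, yk k) (gph (mrestrict S \<Omega> \<Theta>)) \<and>
          xsk k \<in> duality_image (contingent_cone (xk k) \<Omega>) \<and>
          - ysk k \<in> duality_image (contingent_cone (yk k) \<Theta>))"

text \<open>
  Omitting \<open>\<Omega>\<close> or \<open>\<Theta>\<close> in the usual notation corresponds to the argument \<open>UNIV\<close> below.
\<close>

definition normal_coderiv ::
    "('a::real_normed_vector \<Rightarrow> 'b::real_normed_vector set) \<Rightarrow> 'a set \<Rightarrow> 'b set \<Rightarrow> 'a \<Rightarrow> 'b \<Rightarrow>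
     ('b \<Rightarrow>\<^sub>L real) \<Rightarrow> ('a \<Rightarrow>\<^sub>L real) set" where
  "normal_coderiv S \<Omega> \<Theta> x y ys =
     {xs. \<exists>\<epsilon> xk yk xsk ysk. coderiv_seq S \<Omega> \<Theta> x y \<epsilon> xk yk xsk ysk \<and>
        weak_star_tendsto xsk xs \<and> weak_star_tendsto ysk ys}"

definition mixed_coderiv ::
    "('a::real_normed_vector \<Rightarrow> 'b::real_normed_vector set) \<Rightarrow> 'a set \<Rightarrow> 'b set \<Rightarrow> 'a \<Rightarrow> 'b \<Rightarrow>
     ('b \<Rightarrow>\<^sub>L real) \<Rightarrow> ('a \<Rightarrow>\<^sub>L real) set" where
  "mixed_coderiv S \<Omega> \<Theta> x y ys =
     {xs. \<exists>\<epsilon> xk yk xsk ysk. coderiv_seq S \<Omega> \<Theta> x y \<epsilon> xk yk xsk ysk \<and>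
        weak_star_tendsto xsk xs \<and> ysk \<longlonglongrightarrow> ys}"

definition mirror_coderiv ::
    "('a::real_normed_vector \<Rightarrow> 'b::real_normed_vector set) \<Rightarrow> 'a set \<Rightarrow> 'b set \<Rightarrow> 'a \<Rightarrow> 'b \<Rightarrow>
     ('b \<Rightarrow>\<^sub>L real) \<Rightarrow> ('a \<Rightarrow>\<^sub>L real) set" where
  "mirror_coderiv S \<Omega> \<Theta> x y ys =
     {xs. \<exists>\<epsilon> xk yk xsk ysk. coderiv_seq S \<Omega> \<Theta> x y \<epsilon> xk yk xsk ysk \<and>
        xsk \<longlonglongrightarrow> xs \<and> weak_star_tendsto ysk ys}"

definition PSNC ::
    "('a::real_normed_vector \<Rightarrow> 'b::real_normed_vector set) \<Rightarrow> 'a set \<Rightarrow> 'b set \<Rightarrow> 'a \<Rightarrow> 'b \<Rightarrow> bool" where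
  "PSNC S \<Omega> \<Theta> x y \<longleftrightarrow>
     (\<forall>\<epsilon> xk yk xsk ysk. (\<forall>k. \<epsilon> k \<in> {0<..<1}) \<and> coderiv_seq S \<Omega> \<Theta> x y \<epsilon> xk yk xsk ysk \<and>
        weak_star_tendsto xsk 0 \<and> ysk \<longlonglongrightarrow> 0 \<longrightarrow> (\<lambda>k. norm (xsk k)) \<longlonglongrightarrow> 0)"

definition mirror_PSNC ::
    "('a::real_normed_vector \<Rightarrow> 'b::real_normed_vector set) \<Rightarrow> 'a set \<Rightarrow> 'b set \<Rightarrow> 'a \<Rightarrow> 'b \<Rightarrow> bool" where
  "mirror_PSNC S \<Omega> \<Theta> x y \<longleftrightarrow>
     (\<forall>\<epsilon> xk yk xsk ysk. (\<forall>k. \<epsilon> k \<in> {0<..<1}) \<and> coderiv_seq S \<Omega> \<Theta> x y \<epsilon> xk yk xsk ysk \<and>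
        xsk \<longlonglongrightarrow> 0 \<and> weak_star_tendsto ysk 0 \<longrightarrow> (\<lambda>k. norm (ysk k)) \<longlonglongrightarrow> 0)"

definition has_strict_derivative ::
    "('a::real_normed_vector \<Rightarrow> 'b::real_normed_vector) \<Rightarrow> ('a \<Rightarrow>\<^sub>L 'b) \<Rightarrow> 'a \<Rightarrow> bool" where
  "has_strict_derivative f D y \<longleftrightarrow>
     ((\<lambda>(v, u). (f v - f u - blinfun_apply D (v - u)) /\<^sub>R norm (v - u)) \<longlongrightarrow> 0)
        (at (y, y) within {(v, u). v \<noteq> u})"

end

theory Submission
  imports Defs "HOL-Library.Diagonal_Subsequence"
begin

text \<open>
  Why the theorem holds. A point of the graph of the composition restricted to \<open>\<Omega>\<close> and \<open>\<Theta>\<close> is a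
  pair \<open>(x, z)\<close> for which some \<open>y\<close> satisfies \<open>(x, y) \<in> A\<close> and \<open>(y, z) \<in> B\<close>, where \<open>A\<close> and \<open>B\<close> are the
  graphs of \<open>S1\<close> restricted to \<open>\<Omega>\<close> and of \<open>S2\<close> restricted to \<open>\<Theta>\<close>. Take the sequences that define a
  coderivative of the composition; inner semicontinuity supplies intermediate points \<open>y\<^sub>k\<close>
  converging to \<open>ybar\<close>.

  The heart of the proof of the first part is a decoupling step for one index
  (\<open>fuzzy_decoupling\<close>). Let \<open>(xs, - zs)\<close> be an \<open>\<epsilon>\<close>-normal at \<open>(x0, z0)\<close>, and let \<open>h(x, z)\<close> be
  \<open>\<langle>xs, x - x0\<rangle> - \<langle>zs, z - z0\<rangle> - (\<epsilon> + \<gamma>) norm (x - x0, z - z0)\<close> with a small \<open>\<gamma> > 0\<close>,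
  so that \<open>h \<le> 0\<close> near \<open>(x0, z0)\<close> on the graph of the composition. Then the function
  \<open>\<phi>((x, y), (y', z)) = norm (y - y', max 0 (\<sigma>\<^sup>2 - h(x, z)))\<close> is positive on \<open>A \<times> B\<close> near the
  reference point, where its value is \<open>\<sigma>\<^sup>2\<close>. Ekeland's principle gives a nearby minimum point of \<open>\<phi>\<close>
  plus \<open>\<sigma>\<close> times the distance from that point. The squared norm of the intermediate space is Frechet
  differentiable, because the dual norm is locally uniformly convex; the derivative of \<open>\<phi>\<close> with
  respect to \<open>y - y'\<close> and \<open>- h\<close> is a pair \<open>(j, \<beta>)\<close> with \<open>\<beta> \<ge> 0\<close> and \<open>\<beta>\<^sup>2 + (norm j)\<^sup>2 = 1\<close>, and the two partial
  optimality conditions say that \<open>(\<beta> xs, - j)\<close> is almost normal to \<open>A\<close> and \<open>(j, - \<beta> zs)\<close> is almost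
  normal to \<open>B\<close>.

  The relative structure is added by a small perturbation (\<open>relative_fuzzy_decoupling\<close>): for convex
  \<open>\<Omega>\<close> the images \<open>J(T(x; \<Omega>))\<close> are lower semicontinuous in \<open>x \<in> \<Omega>\<close> and closed under nonnegative
  scaling, so \<open>xs\<close> can be replaced by a nearby element of the image at the new point, at the cost of
  enlarging \<open>\<epsilon>\<close>. On the side of the intermediate space the constraint is void, since \<open>J\<close> is onto by
  reflexivity.

  Weak* sequential compactness then gives \<open>j\<^sub>k \<rightharpoonup> l\<close> and \<open>\<beta>\<^sub>k \<longlonglongrightarrow> a\<close> along a subsequence. If \<open>a > 0\<close>,
  division by \<open>\<beta>\<^sub>k\<close> yields the required element \<open>l / a\<close>. If \<open>a = 0\<close>, the functionals \<open>\<beta>\<^sub>k xs\<^sub>k\<close> and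
  \<open>\<beta>\<^sub>k zs\<^sub>k\<close> tend to 0 in norm, the qualification condition forces \<open>l = 0\<close>, and either of the PSNC
  conditions gives \<open>norm (j\<^sub>k) \<longlonglongrightarrow> 0\<close>, which contradicts \<open>\<beta>\<^sub>k\<^sup>2 + (norm j\<^sub>k)\<^sup>2 = 1\<close>
  (\<open>composition_rule\<close>).

  The second part needs no variational argument: by strict differentiability
  \<open>f y - f y\<^sub>k\<close> equals \<open>D (y - y\<^sub>k)\<close> up to an arbitrarily small multiple of the norm of \<open>y - y\<^sub>k\<close>, so
  \<open>(xs\<^sub>k, - zs\<^sub>k o D)\<close> is itself almost normal to \<open>A\<close> (\<open>smooth_composition_rule\<close>).

  The functional analysis behind this consists of the Hahn--Banach theorem, the duality
  mapping, weak* sequential compactness in the dual of a reflexive space, uniform boundedness of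
  weak* convergent sequences, and Ekeland's variational principle.
\<close>

section \<open>Sublinear functionals and the Hahn--Banach theorem\<close>

text \<open>
  The clause for \<open>t = 0\<close> includes \<open>p 0 = 0\<close>. Working with sublinear functionals on the whole space
  makes the Hahn--Banach theorem a statement about minimal elements: no partially defined linear
  functionals have to be extended.
\<close>

definition sublinear :: "('a::real_vector \<Rightarrow> real) \<Rightarrow> bool" where
  "sublinear p \<longleftrightarrow> (\<forall>x y. p (x + y) \<le> p x + p y) \<and> (\<forall>t\<ge>0. \<forall>x. p (t *\<^sub>R x) = t * p x)"

lemma sublinearI:
  assumes "\<And>x y. p (x + y) \<le> p x + p y"
    and "p 0 = 0"
    and "\<And>t x. t > 0 \<Longrightarrow> p (t *\<^sub>R x) \<le> t * p x"
  shows "sublinear p"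
  unfolding sublinear_def
proof (intro conjI allI impI)
  fix t :: real and x assume "0 \<le> t"
  show "p (t *\<^sub>R x) = t * p x"
  proof (cases "t = 0")
    case False
    then have t: "t > 0" using \<open>0 \<le> t\<close> by simp
    have "p ((1/t) *\<^sub>R (t *\<^sub>R x)) \<le> (1/t) * p (t *\<^sub>R x)"
      using t by (intro assms(3)) auto
    then have "t * p x \<le> p (t *\<^sub>R x)" using t by (simp add: field_simps)
    then show ?thesis using assms(3)[OF t, of x] by simp
  qed (use assms(2) in simp)
qed (use assms in auto)

lemma sublinear_add: "sublinear p \<Longrightarrow> p (x + y) \<le> p x + p y"
  and sublinear_scale: "sublinear p \<Longrightarrow> t \<ge> 0 \<Longrightarrow> p (t *\<^sub>R x) = t * p x"
  by (auto simp: sublinear_def)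

lemma sublinear_zero: "sublinear p \<Longrightarrow> p 0 = 0"
  using sublinear_scale[of p 0 0] by simp

lemma sublinear_lower: "sublinear p \<Longrightarrow> - p (- x) \<le> p x"
  using sublinear_add[of p x "- x"] sublinear_zero[of p] by simp

text \<open>
  The common bound \<open>p\<close> keeps the infima finite: a sublinear \<open>q \<le> p\<close> satisfies
  \<open>q x \<ge> - q (- x) \<ge> - p (- x)\<close>.
\<close>

lemma sublinear_INF_chain:
  fixes C :: "('a::real_vector \<Rightarrow> real) set"
  assumes "C \<noteq> {}" and sub: "\<And>q. q \<in> C \<Longrightarrow> sublinear q"
    and dom: "\<And>q x. q \<in> C \<Longrightarrow> q x \<le> p x"
    and chain: "\<And>q r. q \<in> C \<Longrightarrow> r \<in> C \<Longrightarrow> q \<le> r \<or> r \<le> q"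
  shows "sublinear (\<lambda>x. INF q\<in>C. q x)" and "\<And>q x. q \<in> C \<Longrightarrow> (INF q\<in>C. q x) \<le> q x"
proof -
  have bdd: "bdd_below ((\<lambda>q. q x) ` C)" for x
  proof (rule bdd_belowI2)
    fix q assume q: "q \<in> C"
    show "- p (- x) \<le> q x"
      using sublinear_lower[OF sub[OF q], of x] dom[OF q, of "- x"] by linarith
  qed
  show lower: "(INF q\<in>C. q x) \<le> q x" if "q \<in> C" for q x
    using that bdd by (rule cINF_lower[rotated])
  show "sublinear (\<lambda>x. INF q\<in>C. q x)"
  proof (rule sublinearI)
    fix x y
    have "(INF q\<in>C. q (x + y)) \<le> q x + r y" if qr: "q \<in> C" "r \<in> C" for q r
    proof -
      obtain s where s: "s \<in> C" "s \<le> q" "s \<le> r"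
        using chain[OF qr] qr by blast
      have "(INF q\<in>C. q (x + y)) \<le> s (x + y)" using s by (intro lower)
      also have "\<dots> \<le> s x + s y" by (rule sublinear_add[OF sub[OF s(1)]])
      also have "\<dots> \<le> q x + r y" using s by (intro add_mono) (auto simp: le_fun_def)
      finally show ?thesis .
    qed
    then have "(INF q\<in>C. q (x + y)) - r y \<le> (INF q\<in>C. q x)" if "r \<in> C" for r
      using that assms(1) by (intro cINF_greatest) (auto simp: algebra_simps)
    then have "(INF q\<in>C. q (x + y)) - (INF q\<in>C. q x) \<le> (INF q\<in>C. q y)"
      using assms(1) by (intro cINF_greatest) (auto simp: algebra_simps)
    then show "(INF q\<in>C. q (x + y)) \<le> (INF q\<in>C. q x) + (INF q\<in>C. q y)" by simp
  next
    have "(INF q\<in>C. q 0) = (INF q\<in>C. 0::real)"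
      using sub sublinear_zero by (intro INF_cong) auto
    then show "(INF q\<in>C. q 0) = 0" using assms(1) by simp
  next
    fix t :: real and x assume t: "t > 0"
    have "(INF q\<in>C. q (t *\<^sub>R x)) / t \<le> q x" if "q \<in> C" for q
      using lower[OF that, of "t *\<^sub>R x"] sublinear_scale[OF sub[OF that], of t x] t
      by (simp add: field_simps)
    then have "(INF q\<in>C. q (t *\<^sub>R x)) / t \<le> (INF q\<in>C. q x)"
      using assms(1) by (intro cINF_greatest) auto
    then show "(INF q\<in>C. q (t *\<^sub>R x)) \<le> t * (INF q\<in>C. q x)"
      using t by (simp add: field_simps)
  qed
qed

lemma exists_minimal_sublinear:
  fixes p :: "'a::real_vector \<Rightarrow> real"
  assumes "sublinear p"
  obtains q where "sublinear q" "q \<le> p" "\<And>r. sublinear r \<Longrightarrow> r \<le> q \<Longrightarrow> r = q"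
proof -
  define A where "A = {q. sublinear q \<and> q \<le> p}"
  have "\<exists>m\<in>A. \<forall>a\<in>A. a \<le> m \<longrightarrow> a = m"
  proof (rule predicate_Zorn)
    show "partial_order_on A (relation_of (\<lambda>a b. b \<le> a) A)"
      by (rule partial_order_on_relation_ofI) auto
  next
    fix C assume C: "C \<in> Chains (relation_of (\<lambda>a b. b \<le> a) A)"
    have CA: "C \<subseteq> A" using C by (rule Chains_relation_of)
    show "\<exists>u\<in>A. \<forall>a\<in>C. u \<le> a"
    proof (cases "C = {}")
      case True
      then show ?thesis using assms by (auto simp: A_def)
    next
      case False
      have chain: "\<And>q r. q \<in> C \<Longrightarrow> r \<in> C \<Longrightarrow> q \<le> r \<or> r \<le> q"
        using C by (auto simp: Chains_def relation_of_def)
      have sub: "\<And>q. q \<in> C \<Longrightarrow> sublinear q" "\<And>q x. q \<in> C \<Longrightarrow> q x \<le> p x"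
        using CA by (auto simp: A_def le_fun_def)
      have lower: "(INF q\<in>C. q x) \<le> q x" if "q \<in> C" for q x
        by (rule sublinear_INF_chain(2)[of C p]) (fact False sub chain that)+
      let ?u = "\<lambda>x. INF q\<in>C. q x"
      have le: "?u \<le> q" if "q \<in> C" for q
        using lower[OF that] by (auto simp: le_fun_def)
      have "sublinear ?u"
        by (rule sublinear_INF_chain(1)[of C p]) (fact False sub chain)+
      moreover have "?u \<le> p"
      proof -
        obtain q where q: "q \<in> C" using False by auto
        have "q \<le> p" using q CA by (auto simp: A_def)
        then show ?thesis using le[OF q] by (rule order_trans[rotated])
      qed
      ultimately show ?thesis using le by (auto simp: A_def)
    qed
  qed
  then obtain q where q: "q \<in> A" "\<And>a. a \<in> A \<Longrightarrow> a \<le> q \<Longrightarrow> a = q" by blast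
  show thesis
  proof (rule that[of q])
    show "r = q" if "sublinear r" "r \<le> q" for r
      using that q by (auto simp: A_def)
  qed (use q in \<open>auto simp: A_def\<close>)
qed

text \<open>
  The largest functional below \<open>p\<close> that is sublinear and takes a value at most \<open>- p y\<close> at \<open>- y\<close>. It
  serves two purposes: it shows that minimal sublinear functionals are additive, and it provides
  the linear functional that agrees with \<open>p\<close> at \<open>y\<close>.
\<close>

definition directional_minorant :: "('a::real_vector \<Rightarrow> real) \<Rightarrow> 'a \<Rightarrow> 'a \<Rightarrow> real" where
  "directional_minorant p y x = (INF t\<in>{0..}. p (x + t *\<^sub>R y) - t * p y)"

lemma directional_minorant:
  assumes p: "sublinear p"
  shows "sublinear (directional_minorant p y)"
    and "t \<ge> 0 \<Longrightarrow> directional_minorant p y x \<le> p (x + t *\<^sub>R y) - t * p y"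
proof -
  have bdd: "bdd_below ((\<lambda>t. p (x + t *\<^sub>R y) - t * p y) ` {0..})" for x
  proof (rule bdd_belowI2)
    fix t :: real assume t: "t \<in> {0..}"
    have "t * p y \<le> p (x + t *\<^sub>R y) + p (- x)"
      using sublinear_add[OF p, of "x + t *\<^sub>R y" "- x"] sublinear_scale[OF p, of t y] t by simp
    then show "- p (- x) \<le> p (x + t *\<^sub>R y) - t * p y" by simp
  qed
  show lower: "directional_minorant p y x \<le> p (x + t *\<^sub>R y) - t * p y" if "t \<ge> 0" for t x
    unfolding directional_minorant_def using that bdd by (intro cINF_lower) auto
  have greatest: "c \<le> directional_minorant p y x"
    if "\<And>t. t \<ge> 0 \<Longrightarrow> c \<le> p (x + t *\<^sub>R y) - t * p y" for c x
    unfolding directional_minorant_def using that by (intro cINF_greatest) auto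
  show "sublinear (directional_minorant p y)"
  proof (rule sublinearI)
    fix x z
    have "directional_minorant p y (x + z)
        \<le> (p (x + s *\<^sub>R y) - s * p y) + (p (z + t *\<^sub>R y) - t * p y)" if "s \<ge> 0" "t \<ge> 0" for s t
    proof -
      have "directional_minorant p y (x + z) \<le> p (x + z + (s + t) *\<^sub>R y) - (s + t) * p y"
        using that by (intro lower) auto
      moreover have "p (x + z + (s + t) *\<^sub>R y) \<le> p (x + s *\<^sub>R y) + p (z + t *\<^sub>R y)"
        using sublinear_add[OF p, of "x + s *\<^sub>R y" "z + t *\<^sub>R y"] by (simp add: algebra_simps)
      ultimately show ?thesis by (simp add: algebra_simps)
    qed
    then have "directional_minorant p y (x + z) - (p (z + t *\<^sub>R y) - t * p y)
        \<le> directional_minorant p y x" if "t \<ge> 0" for t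
      using that by (intro greatest) (smt (verit))
    then have "directional_minorant p y (x + z) - directional_minorant p y x
        \<le> directional_minorant p y z"
      by (intro greatest) (smt (verit))
    then show "directional_minorant p y (x + z)
        \<le> directional_minorant p y x + directional_minorant p y z" by simp
  next
    show "directional_minorant p y 0 = 0"
      using lower[of 0 0] sublinear_scale[OF p] sublinear_zero[OF p]
      by (intro antisym greatest) auto
  next
    fix t :: real and x assume t: "t > 0"
    have "directional_minorant p y (t *\<^sub>R x) / t \<le> directional_minorant p y x"
    proof (rule greatest)
      fix s :: real assume "s \<ge> 0"
      then have "directional_minorant p y (t *\<^sub>R x) \<le> p (t *\<^sub>R x + (t * s) *\<^sub>R y) - (t * s) * p y"
        using t by (intro lower) auto
      also have "p (t *\<^sub>R x + (t * s) *\<^sub>R y) = t * p (x + s *\<^sub>R y)"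
        using sublinear_scale[OF p, of t "x + s *\<^sub>R y"] t by (simp add: algebra_simps)
      finally show "directional_minorant p y (t *\<^sub>R x) / t \<le> p (x + s *\<^sub>R y) - s * p y"
        using t by (simp add: field_simps)
    qed
    then show "directional_minorant p y (t *\<^sub>R x) \<le> t * directional_minorant p y x"
      using t by (simp add: field_simps)
  qed
qed

lemma minimal_sublinear_linear:
  fixes q :: "'a::real_vector \<Rightarrow> real"
  assumes q: "sublinear q" and min: "\<And>r. sublinear r \<Longrightarrow> r \<le> q \<Longrightarrow> r = q"
  shows "linear q"
proof -
  have dm: "directional_minorant q y = q" for y
    using directional_minorant(1)[OF q, of y] directional_minorant(2)[OF q, of 0 y]
    by (intro min) (auto simp: le_fun_def)
  have add: "q (x + y) = q x + q y" for x y
    using directional_minorant(2)[OF q, of 1 y x] sublinear_add[OF q, of x y] by (simp add: dm)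
  have neg: "q (- x) = - q x" for x
    using add[of x "- x"] sublinear_zero[OF q] by simp
  show ?thesis
  proof (rule linearI)
    fix t x
    show "q (t *\<^sub>R x) = t *\<^sub>R q x"
    proof (cases "t \<ge> 0")
      case False
      have "q (t *\<^sub>R x) = - q ((- t) *\<^sub>R x)" using neg[of "t *\<^sub>R x"] by simp
      also have "\<dots> = t * q x" using sublinear_scale[OF q, of "- t" x] False by simp
      finally show ?thesis by simp
    qed (simp add: sublinear_scale[OF q])
  qed (rule add)
qed

text \<open>
  A minimal sublinear functional below the directional minorant is linear, is dominated by \<open>p\<close>,
  and is at most \<open>- p y\<close> at \<open>- y\<close>, hence equal to \<open>p y\<close> at \<open>y\<close>.
\<close>

theorem Hahn_Banach_sublinear:
  fixes p :: "'a::real_vector \<Rightarrow> real"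
  assumes p: "sublinear p"
  obtains g where "linear g" "\<And>x. g x \<le> p x" "g y = p y"
proof -
  obtain g where g: "sublinear g" "g \<le> directional_minorant p y"
    "\<And>r. sublinear r \<Longrightarrow> r \<le> g \<Longrightarrow> r = g"
    using exists_minimal_sublinear[OF directional_minorant(1)[OF p]] by metis
  have lin: "linear g" using minimal_sublinear_linear g by blast
  have le: "g x \<le> p x" for x
    using g(2) directional_minorant(2)[OF p, of 0 y x] by (auto simp: le_fun_def intro: order_trans)
  have "g (- y) \<le> - p y"
    using g(2) directional_minorant(2)[OF p, of 1 y "- y"] sublinear_zero[OF p]
    by (auto simp: le_fun_def intro: order_trans)
  then have "g y = p y" using le[of y] linear_neg[OF lin, of y] by simp
  with lin le show thesis by (rule that)
qed

lemma Hahn_Banach_blinfun: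
  fixes p :: "'a::real_normed_vector \<Rightarrow> real"
  assumes p: "sublinear p" and bound: "\<And>x. p x \<le> B * norm x" 
  obtains g :: "'a \<Rightarrow>\<^sub>L real"
  where "\<And>x. blinfun_apply g x \<le> p x" "blinfun_apply g y = p y" "\<And>x. \<bar>blinfun_apply g x\<bar> \<le> B * norm x"
proof -
  obtain g where g: "linear g" "\<And>x. g x \<le> p x" "g y = p y"
    using Hahn_Banach_sublinear[OF p] by metis
  have abs: "\<bar>g x\<bar> \<le> B * norm x" for x
    using g(2)[of x] g(2)[of "- x"] bound[of x] bound[of "- x"] linear_neg[OF g(1), of x] by simp
  have "bounded_linear g"
    using g(1) abs by (intro bounded_linear_intro[where K = B])
      (auto simp: linear_add linear_scale mult.commute)
  then have "blinfun_apply (Blinfun g) = g" by (rule bounded_linear_Blinfun_apply)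
  with g abs show thesis by (intro that[of "Blinfun g"]) auto
qed

lemma sublinear_norm: "sublinear (norm :: 'a::real_normed_vector \<Rightarrow> real)"
  by (rule sublinearI) (auto simp: norm_triangle_ineq)

lemma norming_functional:
  fixes x :: "'a::real_normed_vector"
  obtains g :: "'a \<Rightarrow>\<^sub>L real" where "norm g \<le> 1" "blinfun_apply g x = norm x"
proof -
  obtain g :: "'a \<Rightarrow>\<^sub>L real" where "blinfun_apply g x = norm x" "\<And>x. \<bar>blinfun_apply g x\<bar> \<le> 1 * norm x"
    using Hahn_Banach_blinfun[OF sublinear_norm, of 1] by (metis mult_1 order_refl)
  then show thesis by (intro that[of g] norm_blinfun_bound) auto
qed

section \<open>The duality mapping\<close>

lemma duality_map_nonempty:
  fixes x :: "'a::real_normed_vector"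
  obtains j where "j \<in> duality_map x"
proof -
  obtain g :: "'a \<Rightarrow>\<^sub>L real" where g: "norm g \<le> 1" "blinfun_apply g x = norm x"
    by (rule norming_functional)
  have "norm x \<le> norm g * norm x" using norm_blinfun[of g x] g(2) by simp
  then have "norm x * norm g = norm x"
    using g(1) by (intro antisym) (auto simp: mult.commute mult_left_le)
  then have "norm x *\<^sub>R g \<in> duality_map x"
    using g by (simp add: duality_map_def blinfun.scaleR_left power2_eq_square)
  then show thesis by (rule that)
qed

lemma duality_map_scale:
  assumes "j \<in> duality_map x"
  shows "t *\<^sub>R j \<in> duality_map (t *\<^sub>R x)"
  using assms by (auto simp: duality_map_def blinfun.bilinear_simps power2_eq_square)

text \<open>
  Local uniform convexity of the dual norm makes the duality mapping single-valued and continuous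
  for the norms. On unit spheres: if \<open>j\<close> and \<open>j\<^sub>n\<close> norm \<open>w\<close> and \<open>w\<^sub>n\<close>, then
  \<open>norm (j + j\<^sub>n) \<ge> (j + j\<^sub>n) w \<ge> 2 - norm (w - w\<^sub>n)\<close> tends to 2, so \<open>j\<^sub>n\<close> tends to \<open>j\<close>.
\<close>

lemma duality_map_continuous:
  fixes w :: "'a::real_normed_vector"
  assumes luc: "locally_uniformly_convex TYPE('a \<Rightarrow>\<^sub>L real)"
    and j: "j \<in> duality_map w" and jn: "\<And>n. jn n \<in> duality_map (wn n)" and wn: "wn \<longlonglongrightarrow> w"
  shows "jn \<longlonglongrightarrow> j"
proof (cases "w = 0")
  case True
  have "(\<lambda>n. norm (jn n)) \<longlonglongrightarrow> 0"
    using tendsto_norm[OF wn] jn True by (simp add: duality_map_def)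
  moreover have "j = 0" using j True by (simp add: duality_map_def)
  ultimately show ?thesis by (simp add: tendsto_norm_zero_iff)
next
  case False
  define a where "a = (1 / norm w) *\<^sub>R w"
  define f where "f = (1 / norm w) *\<^sub>R j"
  \<comment> \<open>normalisation, with an arbitrary admissible value for the finitely many zero terms\<close>
  define an where "an n = (if wn n = 0 then a else (1 / norm (wn n)) *\<^sub>R wn n)" for n
  define fn where "fn n = (if wn n = 0 then f else (1 / norm (wn n)) *\<^sub>R jn n)" for n
  have fa: "f \<in> duality_map a" unfolding f_def a_def by (rule duality_map_scale[OF j])
  have fan: "fn n \<in> duality_map (an n)" for n
    unfolding fn_def an_def using fa duality_map_scale[OF jn] by auto
  have na: "norm a = 1" using False by (simp add: a_def)
  have nan: "norm (an n) = 1" for n using na by (simp add: an_def)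
  have nf: "norm f = 1" "blinfun_apply f a = 1" using fa na by (auto simp: duality_map_def)
  have nfn: "norm (fn n) = 1" "blinfun_apply (fn n) (an n) = 1" for n
    using fan[of n] nan[of n] by (auto simp: duality_map_def)
  have ev: "\<forall>\<^sub>F n in sequentially. wn n \<noteq> 0"
    using wn False by (rule tendsto_imp_eventually_ne)
  have nwn: "(\<lambda>n. norm (wn n)) \<longlonglongrightarrow> norm w" by (rule tendsto_norm[OF wn])
  have "(\<lambda>n. (1 / norm (wn n)) *\<^sub>R wn n) \<longlonglongrightarrow> a"
    unfolding a_def using False by (intro tendsto_intros wn nwn) auto
  then have an: "an \<longlonglongrightarrow> a"
    by (rule Lim_transform_eventually[OF _ eventually_mono[OF ev]]) (simp add: an_def)
  have lower: "2 - norm (a - an n) \<le> norm (f + fn n)" for n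
  proof -
    have "\<bar>blinfun_apply (fn n) (a - an n)\<bar> \<le> norm (a - an n)"
      using norm_blinfun[of "fn n" "a - an n"] nfn by simp
    moreover have "\<bar>blinfun_apply (f + fn n) a\<bar> \<le> norm (f + fn n)"
      using norm_blinfun[of "f + fn n" a] na by simp
    ultimately show ?thesis using nf nfn[of n] by (simp add: blinfun.bilinear_simps)
  qed
  have upper: "norm (f + fn n) \<le> 2" for n
    using norm_triangle_ineq[of f "fn n"] nf nfn[of n] by simp
  have "(\<lambda>n. 2 - norm (a - an n)) \<longlonglongrightarrow> 2 - norm (a - a)"
    by (intro tendsto_intros an)
  then have lim: "(\<lambda>n. 2 - norm (a - an n)) \<longlonglongrightarrow> 2" by simp
  have "(\<lambda>n. norm (f + fn n)) \<longlonglongrightarrow> 2"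
    by (rule tendsto_sandwich[OF _ _ lim tendsto_const]) (simp_all add: lower upper)
  then have "fn \<longlonglongrightarrow> f"
    using luc nf nfn unfolding locally_uniformly_convex_def by blast
  then have "(\<lambda>n. norm (wn n) *\<^sub>R fn n) \<longlonglongrightarrow> norm w *\<^sub>R f"
    by (intro tendsto_intros nwn)
  moreover have "norm w *\<^sub>R f = j" using False by (simp add: f_def)
  ultimately have "(\<lambda>n. norm (wn n) *\<^sub>R fn n) \<longlonglongrightarrow> j" by simp
  then show ?thesis
    by (rule Lim_transform_eventually[OF _ eventually_mono[OF ev]]) (simp add: fn_def)
qed

text \<open>
  A functional that norms \<open>f\<close> in the bidual is evaluation at a point \<open>x\<close> by reflexivity, and
  \<open>norm x \<le> 1\<close> follows by testing with a functional that norms \<open>x\<close>.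
\<close>

lemma duality_map_surj:
  fixes f :: "'a::real_normed_vector \<Rightarrow>\<^sub>L real"
  assumes "reflexive_space TYPE('a)"
  obtains x where "f \<in> duality_map x"
proof -
  obtain \<Phi> :: "('a \<Rightarrow>\<^sub>L real) \<Rightarrow>\<^sub>L real" where \<Phi>: "norm \<Phi> \<le> 1" "blinfun_apply \<Phi> f = norm f"
    by (rule norming_functional)
  obtain x where x: "\<And>g. blinfun_apply \<Phi> g = blinfun_apply g x"
    using assms by (auto simp: reflexive_space_def)
  obtain g :: "'a \<Rightarrow>\<^sub>L real" where g: "norm g \<le> 1" "blinfun_apply g x = norm x"
    by (rule norming_functional)
  have "norm x = blinfun_apply \<Phi> g" using x g by simp
  also have "\<dots> \<le> norm \<Phi> * norm g" using norm_blinfun[of \<Phi> g] by simp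
  also have "\<dots> \<le> 1" using \<Phi> g by (simp add: mult_le_one)
  finally have x1: "norm x \<le> 1" .
  have fx: "blinfun_apply f x = norm f" using \<Phi> x by simp
  have "norm f \<le> norm f * norm x" using norm_blinfun[of f x] fx by simp
  then have "norm f * norm x = norm f"
    using x1 by (intro antisym) (auto simp: mult_left_le)
  then have "norm (norm f *\<^sub>R x) = norm f" by (simp only: norm_scaleR abs_norm_cancel)
  then have "f \<in> duality_map (norm f *\<^sub>R x)"
    using fx unfolding duality_map_def by (auto simp: blinfun.scaleR_right power2_eq_square)
  then show thesis by (rule that)
qed

section \<open>Weak* sequential compactness\<close>

lemma pointwise_convergent_subsequence:
  fixes F :: "nat \<Rightarrow> nat \<Rightarrow> real"
  assumes "\<And>n i. \<bar>F n i\<bar> \<le> b i"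
  obtains r where "strict_mono r" "\<And>i. convergent (\<lambda>n. F (r n) i)"
proof -
  interpret subseqs "\<lambda>i s. convergent (\<lambda>n. F (s n) i)"
  proof
    fix i and s :: "nat \<Rightarrow> nat"
    have "bounded (range (\<lambda>n. F (s n) i))"
      using assms by (auto simp: bounded_iff)
    then obtain l r where "strict_mono r" "((\<lambda>n. F (s n) i) \<circ> r) \<longlonglongrightarrow> l"
      using bounded_imp_convergent_subsequence by blast
    then show "\<exists>r. strict_mono r \<and> convergent (\<lambda>n. F ((s \<circ> r) n) i)"
      by (auto simp: convergent_def o_def)
  qed
  have "convergent (\<lambda>n. F ((diagseq \<circ> (+) (Suc i)) n) i)" for i
  proof (rule diagseq_holds)
    fix r s :: "nat \<Rightarrow> nat" and n
    assume "strict_mono r" "convergent (\<lambda>k. F (s k) n)"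
    then show "convergent (\<lambda>k. F ((s \<circ> r) k) n)"
      using convergent_subseq_convergent[of "\<lambda>k. F (s k) n" r] by (simp add: o_def)
  qed
  then have "convergent (\<lambda>n. F (diagseq (n + Suc i)) i)" for i
    unfolding o_def add.commute[of _ "Suc i"] .
  then have "convergent (\<lambda>n. F (diagseq n) i)" for i
    using convergent_ignore_initial_segment[of "\<lambda>n. F (diagseq n) i" "Suc i"] by blast
  with subseq_diagseq show thesis by (rule that)
qed

text \<open>
  \<open>Q\<close> is the set of all finite rational combinations of the terms of \<open>f\<close>.
\<close>

lemma separable_span:
  fixes f :: "nat \<Rightarrow> 'a::real_normed_vector"
  obtains Q where "countable Q" "range f \<subseteq> Q" "subspace (closure Q)"
proof -
  define comb where "comb l = sum_list (map (\<lambda>(i, q). of_rat q *\<^sub>R f i) l)" for l :: "(nat \<times> rat) list"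
  define Q where "Q = range comb"
  have f: "f i \<in> Q" for i
  proof -
    have "f i = comb [(i, 1)]" by (simp add: comb_def)
    then show ?thesis by (simp add: Q_def)
  qed
  have add: "x + y \<in> Q" if xy: "x \<in> Q" "y \<in> Q" for x y
  proof -
    obtain k l where "x = comb k" "y = comb l" using xy by (auto simp: Q_def)
    then have "x + y = comb (k @ l)" by (simp add: comb_def)
    then show ?thesis by (simp add: Q_def)
  qed
  have scale: "of_rat q *\<^sub>R x \<in> Q" if x: "x \<in> Q" for q x
  proof -
    obtain l where l: "x = comb l" using x by (auto simp: Q_def)
    have "of_rat q *\<^sub>R comb l = comb (map (\<lambda>(i, p). (i, q * p)) l)"
      by (induction l) (auto simp: comb_def scaleR_add_right of_rat_mult)
    then show ?thesis using l by (simp add: Q_def)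
  qed
  have "subspace (closure Q)"
    unfolding subspace_def
  proof (intro conjI ballI allI)
    have "comb [] = 0" by (simp add: comb_def)
    then show "0 \<in> closure Q" using closure_subset[of Q] by (metis Q_def rangeI subsetD)
  next
    fix x y assume "x \<in> closure Q" "y \<in> closure Q"
    then obtain u v where "\<forall>n. u n \<in> Q" "u \<longlonglongrightarrow> x" "\<forall>n. v n \<in> Q" "v \<longlonglongrightarrow> y"
      by (auto simp: closure_sequential)
    then have "\<forall>n. u n + v n \<in> Q" "(\<lambda>n. u n + v n) \<longlonglongrightarrow> x + y"
      by (auto intro: add tendsto_add)
    then show "x + y \<in> closure Q"
      unfolding closure_sequential by (intro exI[of _ "\<lambda>n. u n + v n"]) auto
  next
    fix c :: real and x assume "x \<in> closure Q"
    then obtain u where u: "\<forall>n. u n \<in> Q" "u \<longlonglongrightarrow> x"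
      by (auto simp: closure_sequential)
    have "\<exists>q. c < of_rat q \<and> of_rat q < c + inverse (real (Suc n))" for n
      by (rule of_rat_dense) simp
    then obtain q where q: "\<And>n. c < of_rat (q n)" "\<And>n. of_rat (q n) < c + inverse (real (Suc n))"
      by metis
    have lim: "(\<lambda>n. c + inverse (real (Suc n))) \<longlonglongrightarrow> c"
      using tendsto_add[OF tendsto_const LIMSEQ_inverse_real_of_nat, of c] by simp
    have "(\<lambda>n. of_rat (q n)) \<longlonglongrightarrow> c"
      by (rule tendsto_sandwich[OF _ _ tendsto_const lim]) (use q in \<open>auto intro: less_imp_le always_eventually\<close>)
    then have "(\<lambda>n. of_rat (q n) *\<^sub>R u n) \<longlonglongrightarrow> c *\<^sub>R x"
      using u by (intro tendsto_scaleR)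
    moreover have "\<forall>n. of_rat (q n) *\<^sub>R u n \<in> Q" using u scale by blast
    ultimately show "c *\<^sub>R x \<in> closure Q"
      unfolding closure_sequential by (intro exI[of _ "\<lambda>n. of_rat (q n) *\<^sub>R u n"]) auto
  qed
  then show thesis using that[of Q] f by (auto simp: Q_def)
qed

lemma sublinear_infdist:
  fixes M :: "'a::real_normed_vector set"
  assumes M: "subspace M"
  shows "sublinear (\<lambda>x. infdist x M)"
proof (rule sublinearI)
  have ne: "M \<noteq> {}" using subspace_0[OF M] by auto
  have greatest: "c \<le> infdist x M" if "\<And>a. a \<in> M \<Longrightarrow> c \<le> dist x a" for c x
    unfolding infdist_notempty[OF ne] using ne that by (rule cINF_greatest)
  {
    fix x y
    have "infdist (x + y) M \<le> dist x a + dist y b" if "a \<in> M" "b \<in> M" for a b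
    proof -
      have "infdist (x + y) M \<le> dist (x + y) (a + b)"
        using that M by (intro infdist_le subspace_add)
      also have "\<dots> \<le> dist x a + dist y b" by (rule dist_triangle_add)
      finally show ?thesis .
    qed
    then have "infdist (x + y) M - dist y b \<le> infdist x M" if "b \<in> M" for b
      using that by (intro greatest) (smt (verit))
    then have "infdist (x + y) M - infdist x M \<le> infdist y M"
      by (intro greatest) (smt (verit))
    then show "infdist (x + y) M \<le> infdist x M + infdist y M" by simp
  }
  show "infdist 0 M = 0" using subspace_0[OF M] by simp
  fix t :: real and x assume t: "t > 0"
  have "infdist (t *\<^sub>R x) M / t \<le> infdist x M"
  proof (rule greatest)
    fix a assume "a \<in> M"
    then have "infdist (t *\<^sub>R x) M \<le> dist (t *\<^sub>R x) (t *\<^sub>R a)"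
      using M by (intro infdist_le subspace_scale)
    also have "\<dots> = t * dist x a"
      using t by (simp add: dist_norm flip: scaleR_diff_right)
    finally show "infdist (t *\<^sub>R x) M / t \<le> dist x a" using t by (simp add: field_simps)
  qed
  then show "infdist (t *\<^sub>R x) M \<le> t * infdist x M" using t by (simp add: field_simps)
qed

text \<open>
  The functional on the dual comes from the Hahn--Banach theorem applied to the distance from \<open>M\<close>;
  reflexivity turns it into a point of the space.
\<close>

lemma reflexive_separation:
  fixes M :: "('a::real_normed_vector \<Rightarrow>\<^sub>L real) set"
  assumes refl: "reflexive_space TYPE('a)" and M: "subspace M" "closed M" and g: "g \<notin> M"
  obtains x where "\<And>f. f \<in> M \<Longrightarrow> blinfun_apply f x = 0" "blinfun_apply g x \<noteq> 0"
proof -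
  have zero: "0 \<in> M" by (rule subspace_0[OF M(1)])
  have "infdist h M \<le> 1 * norm h" for h using infdist_le[OF zero, of h] by simp
  then obtain \<Phi> where \<Phi>: "\<And>h. blinfun_apply \<Phi> h \<le> infdist h M" "blinfun_apply \<Phi> g = infdist g M"
    using Hahn_Banach_blinfun[OF sublinear_infdist[OF M(1)], of 1 g] by metis
  obtain x where x: "\<And>h. blinfun_apply \<Phi> h = blinfun_apply h x"
    using refl by (auto simp: reflexive_space_def)
  have "blinfun_apply f x = 0" if "f \<in> M" for f
    using \<Phi>(1)[of f] \<Phi>(1)[of "- f"] x[of f] x[of "- f"] that subspace_neg[OF M(1) that]
    by (simp add: blinfun.minus_left)
  moreover have "infdist g M \<noteq> 0"
    using in_closed_iff_infdist_zero[OF M(2), of g] zero g by auto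
  ultimately show thesis using that[of x] \<Phi>(2) x by simp
qed

text \<open>
  The functional is \<open>p x = limsup\<^sub>n (f\<^sub>n x)\<close>, expressed through the only two properties of an upper
  limit that matter later.
\<close>

lemma limsup_functional:
  fixes f :: "nat \<Rightarrow> 'a::real_normed_vector \<Rightarrow>\<^sub>L real"
  assumes B: "\<And>n. norm (f n) \<le> B"
  obtains p where "sublinear p" "\<And>x. p x \<le> B * norm x"
    "\<And>x c. (\<forall>\<^sub>F n in sequentially. blinfun_apply (f n) x \<le> c) \<Longrightarrow> p x \<le> c"
    "\<And>x c. p x < c \<Longrightarrow> \<forall>\<^sub>F n in sequentially. blinfun_apply (f n) x < c"
proof -
  define U where "U x = {c. \<forall>\<^sub>F n in sequentially. blinfun_apply (f n) x \<le> c}" for x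
  have abs: "\<bar>blinfun_apply (f n) x\<bar> \<le> B * norm x" for n x
    using norm_blinfun[of "f n" x] mult_right_mono[OF B[of n] norm_ge_zero[of x]] by simp
  have BU: "B * norm x \<in> U x" for x
    using abs[THEN abs_le_D1] by (simp add: U_def)
  have bdd: "bdd_below (U x)" for x
  proof (rule bdd_belowI)
    fix c assume "c \<in> U x"
    then obtain n where "blinfun_apply (f n) x \<le> c"
      unfolding U_def eventually_sequentially by auto
    then show "- (B * norm x) \<le> c" using abs[of n x] by linarith
  qed
  have lower: "Inf (U x) \<le> c" if "c \<in> U x" for x c
    using that bdd by (rule cInf_lower)
  have approx: "\<exists>c'\<in>U x. c' < c" if "Inf (U x) < c" for x c
    using that BU[of x] by (subst (asm) cInf_less_iff[OF _ bdd]) auto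
  show thesis
  proof (rule that[of "\<lambda>x. Inf (U x)"])
    show "sublinear (\<lambda>x. Inf (U x))"
    proof (rule sublinearI)
      fix x y
      show "Inf (U (x + y)) \<le> Inf (U x) + Inf (U y)"
      proof (rule field_le_epsilon)
        fix e :: real assume "e > 0"
        obtain c d where c: "c \<in> U x" "c < Inf (U x) + e / 2" and d: "d \<in> U y" "d < Inf (U y) + e / 2"
          using approx[of x "Inf (U x) + e / 2"] approx[of y "Inf (U y) + e / 2"] \<open>e > 0\<close> by auto
        have "c + d \<in> U (x + y)"
          using c(1) d(1) unfolding U_def mem_Collect_eq
          by eventually_elim (simp add: blinfun.add_right)
        then show "Inf (U (x + y)) \<le> Inf (U x) + Inf (U y) + e"
          using lower c d by (smt (verit) field_sum_of_halves)
      qed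
    next
      have "U 0 = {0..}" by (auto simp: U_def)
      then show "Inf (U 0) = 0" by simp
    next
      fix t :: real and x assume t: "t > 0"
      have "Inf (U (t *\<^sub>R x)) / t \<le> Inf (U x)"
      proof (rule cInf_greatest)
        fix c assume "c \<in> U x"
        then have "t * c \<in> U (t *\<^sub>R x)"
          unfolding U_def mem_Collect_eq by eventually_elim (use t in \<open>simp add: blinfun.scaleR_right\<close>)
        then show "Inf (U (t *\<^sub>R x)) / t \<le> c" using lower t by (simp add: field_simps)
      qed (use BU in auto)
      then show "Inf (U (t *\<^sub>R x)) \<le> t * Inf (U x)" using t by (simp add: field_simps)
    qed
    show "Inf (U x) \<le> B * norm x" for x by (rule lower[OF BU])
    show "Inf (U x) \<le> c" if "\<forall>\<^sub>F n in sequentially. blinfun_apply (f n) x \<le> c" for x c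
      using that by (intro lower) (simp add: U_def)
    show "\<forall>\<^sub>F n in sequentially. blinfun_apply (f n) x < c" if "Inf (U x) < c" for x c
      using approx[OF that] by (auto simp: U_def elim: eventually_mono)
  qed
qed

text \<open>
  Let \<open>Q\<close> be countable and dense in the closed span \<open>M\<close> of the sequence, and choose for every
  \<open>q \<in> Q\<close> a point of the unit ball at which \<open>q\<close> attains its norm. A diagonal subsequence converges at all of
  these points. Put \<open>p x = limsup\<^sub>n (f\<^sub>n x)\<close> along it. Every linear functional below \<open>p\<close> lies in \<open>M\<close>
  and takes the limit value at each chosen point, and two elements of \<open>M\<close> that agree at these points are
  equal. So \<open>p\<close> dominates only one linear functional \<open>g\<close>; since some functional below \<open>p\<close> touches \<open>p\<close>
  at any prescribed point, \<open>p = g\<close>, and then upper and lower limits agree everywhere.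
\<close>

theorem weak_star_convergent_subsequence:
  fixes f :: "nat \<Rightarrow> 'a::real_normed_vector \<Rightarrow>\<^sub>L real"
  assumes refl: "reflexive_space TYPE('a)" and B: "\<And>n. norm (f n) \<le> B"
  obtains r g where "strict_mono (r :: nat \<Rightarrow> nat)" "weak_star_tendsto (\<lambda>n. f (r n)) g"
proof -
  obtain Q where Q: "countable Q" "range f \<subseteq> Q" "subspace (closure Q)"
    by (rule separable_span)
  have ne: "Q \<noteq> {}" using Q(2) by auto
  have "\<exists>x. norm x \<le> 1 \<and> norm q = blinfun_apply q x" for q :: "'a \<Rightarrow>\<^sub>L real"
  proof -
    obtain x where x: "q \<in> duality_map x" using duality_map_surj[OF refl] by blast
    show ?thesis
      by (rule exI[of _ "(1 / norm x) *\<^sub>R x"])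
        (use x in \<open>auto simp: duality_map_def blinfun.scaleR_right power2_eq_square\<close>)
  qed
  then obtain X :: "('a \<Rightarrow>\<^sub>L real) \<Rightarrow> 'a"
    where X: "\<And>q. norm (X q) \<le> 1" "\<And>q. norm q = blinfun_apply q (X q)"
    by metis
  define x where "x i = X (from_nat_into Q i)" for i
  have "\<bar>blinfun_apply (f n) (x i)\<bar> \<le> B" for n i
  proof -
    have "\<bar>blinfun_apply (f n) (x i)\<bar> \<le> norm (f n) * norm (x i)"
      using norm_blinfun[of "f n" "x i"] by simp
    also have "\<dots> \<le> norm (f n)" using X(1) by (simp add: x_def mult_left_le)
    finally show ?thesis using B[of n] by simp
  qed
  then obtain r where r: "strict_mono r" "\<And>i. convergent (\<lambda>n. blinfun_apply (f (r n)) (x i))"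
    using pointwise_convergent_subsequence[of "\<lambda>n i. blinfun_apply (f n) (x i)" "\<lambda>_. B"] by metis
  obtain p where p: "sublinear p" "\<And>x. p x \<le> B * norm x"
    "\<And>x c. (\<forall>\<^sub>F n in sequentially. blinfun_apply (f (r n)) x \<le> c) \<Longrightarrow> p x \<le> c"
    "\<And>x c. p x < c \<Longrightarrow> \<forall>\<^sub>F n in sequentially. blinfun_apply (f (r n)) x < c"
    using limsup_functional[of "\<lambda>n. f (r n)" B] B by metis
  \<comment> \<open>otherwise a point annihilates all \<open>f\<^sub>n\<close>, hence \<open>p\<close> in both directions, but not \<open>g\<close>\<close>
  have span: "g \<in> closure Q" if g: "\<And>x. blinfun_apply g x \<le> p x" for g :: "'a \<Rightarrow>\<^sub>L real"
  proof (rule ccontr)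
    assume "g \<notin> closure Q"
    then obtain y where y: "\<And>f. f \<in> closure Q \<Longrightarrow> blinfun_apply f y = 0" "blinfun_apply g y \<noteq> 0"
      using reflexive_separation[OF refl Q(3)] by (metis closed_closure)
    have "blinfun_apply (f (r n)) y = 0" for n
      using y(1) Q(2) closure_subset[of Q] by blast
    then have "p y \<le> 0" "p (- y) \<le> 0"
      by (auto intro!: p(3) simp: blinfun.minus_right)
    then show False using g[of y] g[of "- y"] y(2) by (simp add: blinfun.minus_right)
  qed
  have val: "blinfun_apply g (x i) = lim (\<lambda>n. blinfun_apply (f (r n)) (x i))"
    if g: "\<And>x. blinfun_apply g x \<le> p x" for g :: "'a \<Rightarrow>\<^sub>L real" and i
  proof -
    define l where "l = lim (\<lambda>n. blinfun_apply (f (r n)) (x i))"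
    have l: "(\<lambda>n. blinfun_apply (f (r n)) (x i)) \<longlonglongrightarrow> l"
      using r(2)[of i] by (simp add: l_def convergent_LIMSEQ_iff)
    have "p (x i) \<le> l + e" if "e > 0" for e
      using order_tendstoD(2)[OF l, of "l + e"] that by (intro p(3)) (auto elim: eventually_mono)
    then have "p (x i) \<le> l" by (rule field_le_epsilon)
    moreover have "p (- x i) \<le> - l + e" if "e > 0" for e
      using order_tendstoD(1)[OF l, of "l - e"] that
      by (intro p(3)) (auto elim: eventually_mono simp: blinfun.minus_right)
    then have "p (- x i) \<le> - l" by (rule field_le_epsilon)
    ultimately show ?thesis
      using g[of "x i"] g[of "- x i"] by (simp add: l_def blinfun.minus_right)
  qed
  have unique: "g = h" if g: "\<And>x. blinfun_apply g x \<le> p x" and h: "\<And>x. blinfun_apply h x \<le> p x"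
    for g h :: "'a \<Rightarrow>\<^sub>L real"
  proof -
    have "g - h \<in> closure Q" using span[OF g] span[OF h] Q(3) by (rule subspace_diff[rotated 1])
    have "norm (g - h) \<le> 0"
    proof (rule field_le_epsilon)
      fix e :: real assume "e > 0"
      then obtain q where q: "q \<in> Q" "dist q (g - h) < e / 2"
        using \<open>g - h \<in> closure Q\<close> by (meson closure_approachable half_gt_zero)
      obtain i where i: "q = from_nat_into Q i"
        using from_nat_into_surj[OF Q(1) q(1)] by metis
      have "blinfun_apply (g - h) (x i) = 0"
        using val[OF g] val[OF h] by (simp add: blinfun.diff_left)
      then have "norm q = blinfun_apply (q - (g - h)) (x i)"
        using X(2)[of q] by (simp add: x_def i blinfun.diff_left)
      also have "\<dots> \<le> norm (q - (g - h)) * norm (x i)"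
        using norm_blinfun[of "q - (g - h)" "x i"] by simp
      also have "\<dots> \<le> norm (q - (g - h))" using X(1) by (simp add: x_def mult_left_le)
      finally have "norm q \<le> norm (q - (g - h))" .
      then show "norm (g - h) \<le> 0 + e"
        using q(2) norm_triangle_ineq4[of q "q - (g - h)"] by (simp add: dist_norm)
    qed
    then show ?thesis by simp
  qed
  obtain g :: "'a \<Rightarrow>\<^sub>L real" where g: "\<And>x. blinfun_apply g x \<le> p x"
    using Hahn_Banach_blinfun[OF p(1,2)] by metis
  have gp: "blinfun_apply g y = p y" for y
  proof -
    obtain h :: "'a \<Rightarrow>\<^sub>L real" where h: "\<And>x. blinfun_apply h x \<le> p x" "blinfun_apply h y = p y"
      using Hahn_Banach_blinfun[OF p(1,2), of y] by metis
    then show ?thesis using unique[OF g h(1)] by simp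
  qed
  have "(\<lambda>n. blinfun_apply (f (r n)) y) \<longlonglongrightarrow> blinfun_apply g y" for y
  proof (rule order_tendstoI)
    fix c assume "c < blinfun_apply g y"
    then have "p (- y) < - c" using gp[of "- y"] by (simp add: blinfun.minus_right)
    from p(4)[OF this] show "\<forall>\<^sub>F n in sequentially. c < blinfun_apply (f (r n)) y"
      by (simp add: blinfun.minus_right)
  next
    fix c assume "blinfun_apply g y < c"
    then show "\<forall>\<^sub>F n in sequentially. blinfun_apply (f (r n)) y < c"
      by (intro p(4)) (simp add: gp)
  qed
  with r(1) show thesis by (intro that[of r g]) (auto simp: weak_star_tendsto_def)
qed

text \<open>
  The uniform boundedness principle, from the Baire category theorem.
\<close>

lemma weak_star_convergent_bounded:
  fixes f :: "nat \<Rightarrow> 'a::banach \<Rightarrow>\<^sub>L real"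
  assumes "weak_star_tendsto f g"
  obtains B where "\<And>n. norm (f n) \<le> B" "B \<ge> 0"
proof -
  define E where "E m = {x. \<forall>n. \<bar>blinfun_apply (f n) x\<bar> \<le> real m}" for m
  have closed: "closed (E m)" for m
  proof -
    have "E m = (\<Inter>n. {x. \<bar>blinfun_apply (f n) x\<bar> \<le> real m})" by (auto simp: E_def)
    moreover have "closed {x. \<bar>blinfun_apply (f n) x\<bar> \<le> real m}" for n
      by (intro closed_Collect_le continuous_intros)
    ultimately show ?thesis by auto
  qed
  have cover: "\<Union> (range E) = UNIV"
  proof -
    have "\<exists>m. x \<in> E m" for x
    proof -
      have "convergent (\<lambda>n. blinfun_apply (f n) x)"
        using assms by (auto simp: weak_star_tendsto_def convergent_def)
      then obtain K where K: "\<And>n. \<bar>blinfun_apply (f n) x\<bar> \<le> K"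
        using convergent_imp_Bseq[of "\<lambda>n. blinfun_apply (f n) x"] by (auto simp: Bseq_def)
      obtain m where "K \<le> real m" using real_arch_simple by blast
      then show ?thesis using K by (auto simp: E_def intro: order_trans)
    qed
    then show ?thesis by auto
  qed
  have "\<exists>m. interior (E m) \<noteq> {}"
  proof (rule ccontr)
    assume "\<not> ?thesis"
    then have "euclidean interior_of \<Union> (range E) = {}"
      using closed by (intro Baire_category_alt) (auto simp: completely_metrizable_space_euclidean)
    then show False by (simp add: cover)
  qed
  then obtain m a where "a \<in> interior (E m)" by blast
  then obtain e where e: "e > 0" "cball a e \<subseteq> E m"
    by (metis interior_subset mem_interior_cball)
  have "norm (f n) \<le> 2 * real m / e" for n
  proof (rule norm_blinfun_bound)
    fix x
    show "norm (blinfun_apply (f n) x) \<le> 2 * real m / e * norm x"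
    proof (cases "x = 0")
      case False
      define y where "y = (e / norm x) *\<^sub>R x"
      have "norm y \<le> e" using False e by (simp add: y_def)
      then have "a \<in> E m" "a + y \<in> E m" using e by (auto simp: dist_norm subset_iff)
      then have "\<bar>blinfun_apply (f n) a\<bar> \<le> real m" "\<bar>blinfun_apply (f n) (a + y)\<bar> \<le> real m"
        by (auto simp: E_def)
      then have "\<bar>blinfun_apply (f n) y\<bar> \<le> 2 * real m" by (simp add: blinfun.add_right)
      moreover have "\<bar>blinfun_apply (f n) y\<bar> = e / norm x * \<bar>blinfun_apply (f n) x\<bar>"
        using e by (simp add: y_def blinfun.scaleR_right abs_mult)
      ultimately show ?thesis using False e by (simp add: field_simps)
    qed simp
  qed (use e in auto)
  then show thesis using e by (intro that[of "2 * real m / e"]) auto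
qed

section \<open>Ekeland's variational principle\<close>

theorem Ekeland:
  fixes \<phi> :: "'a::complete_space \<Rightarrow> real"
  assumes K: "closed K" "u0 \<in> K" and cont: "continuous_on K \<phi>"
    and nonneg: "\<And>u. u \<in> K \<Longrightarrow> 0 \<le> \<phi> u" and c: "c > 0"
  obtains v where "v \<in> K" "\<phi> v + c * dist v u0 \<le> \<phi> u0"
    "\<And>u. u \<in> K \<Longrightarrow> \<phi> v \<le> \<phi> u + c * dist u v"
proof -
  \<comment> \<open>the points that improve on \<open>v\<close> by at least \<open>c\<close> times their distance from \<open>v\<close>\<close>
  define S where "S v = {u \<in> K. \<phi> u + c * dist u v \<le> \<phi> v}" for v
  \<comment> \<open>some improvement realises at least half of the possible decrease\<close>
  have step: "\<exists>u\<in>S v. \<forall>w\<in>S v. \<phi> u \<le> (\<phi> v + \<phi> w) / 2" if v: "v \<in> K" for v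
  proof -
    have vS: "v \<in> S v" using v by (simp add: S_def)
    have bdd: "bdd_below (\<phi> ` S v)" by (rule bdd_belowI2[of _ 0]) (auto simp: S_def nonneg)
    define m where "m = (INF u\<in>S v. \<phi> u)"
    have m: "m \<le> \<phi> w" if "w \<in> S v" for w
      unfolding m_def using bdd that by (rule cINF_lower)
    show ?thesis
    proof (cases "\<phi> v = m")
      case True
      then show ?thesis using vS m by (intro bexI[of _ v]) auto
    next
      case False
      then have "m < (\<phi> v + m) / 2" using m[OF vS] by simp
      then obtain u where "u \<in> S v" "\<phi> u < (\<phi> v + m) / 2"
        unfolding m_def using vS by (subst (asm) cINF_less_iff[OF _ bdd]) auto
      then show ?thesis using m by (intro bexI[of _ u]) (auto, smt (verit) field_sum_of_halves)
    qed
  qed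
  have "\<exists>u. \<forall>n. (u n \<in> K \<and> (n = 0 \<longrightarrow> u n = u0)) \<and>
      (u (Suc n) \<in> S (u n) \<and> (\<forall>w\<in>S (u n). \<phi> (u (Suc n)) \<le> (\<phi> (u n) + \<phi> w) / 2))"
  proof (rule dependent_nat_choice)
    fix x and n :: nat assume "x \<in> K \<and> (n = 0 \<longrightarrow> x = u0)"
    then show "\<exists>y. (y \<in> K \<and> (Suc n = 0 \<longrightarrow> y = u0)) \<and>
        (y \<in> S x \<and> (\<forall>w\<in>S x. \<phi> y \<le> (\<phi> x + \<phi> w) / 2))"
      using step[of x] by (auto simp: S_def)
  qed (use K in auto)
  then obtain u where u: "\<And>n. u n \<in> K" "u 0 = u0" "\<And>n. u (Suc n) \<in> S (u n)"
    "\<And>n w. w \<in> S (u n) \<Longrightarrow> \<phi> (u (Suc n)) \<le> (\<phi> (u n) + \<phi> w) / 2"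
    by blast
  have "\<phi> (u (n + k)) + c * dist (u (n + k)) (u n) \<le> \<phi> (u n)" for n k
  proof (induction k)
    case (Suc k)
    have "\<phi> (u (Suc (n + k))) + c * dist (u (Suc (n + k))) (u (n + k)) \<le> \<phi> (u (n + k))"
      using u(3)[of "n + k"] by (simp add: S_def)
    moreover have "c * dist (u (Suc (n + k))) (u n)
        \<le> c * dist (u (Suc (n + k))) (u (n + k)) + c * dist (u (n + k)) (u n)"
      using c dist_triangle[of "u (Suc (n + k))" "u n" "u (n + k)"]
      by (simp flip: distrib_left)
    ultimately show ?case using Suc by simp
  qed simp
  then have desc: "\<phi> (u m) + c * dist (u m) (u n) \<le> \<phi> (u n)" if "n \<le> m" for m n
    using that by (metis le_add_diff_inverse)
  have "decseq (\<lambda>n. \<phi> (u n))"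
    using desc c by (auto simp: decseq_def) (smt (verit) mult_nonneg_nonneg zero_le_dist)
  then obtain L where L: "(\<lambda>n. \<phi> (u n)) \<longlonglongrightarrow> L" "\<And>n. L \<le> \<phi> (u n)"
    using decseq_convergent[of "\<lambda>n. \<phi> (u n)" 0] nonneg u(1) by metis
  have "Cauchy u"
  proof (rule metric_CauchyI)
    fix e :: real assume "e > 0"
    then have "\<forall>\<^sub>F n in sequentially. \<phi> (u n) < L + c * e / 2"
      using c by (intro order_tendstoD(2)[OF L(1)]) simp
    then obtain N where N: "\<phi> (u N) < L + c * e / 2" by (auto simp: eventually_sequentially)
    have near: "dist (u n) (u N) < e / 2" if "n \<ge> N" for n
    proof -
      have "c * dist (u n) (u N) < c * (e / 2)" using desc[OF that] L(2)[of n] N by simp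
      then show ?thesis using c by simp
    qed
    show "\<exists>M. \<forall>m\<ge>M. \<forall>n\<ge>M. dist (u m) (u n) < e"
    proof (intro exI[of _ N] allI impI)
      fix m n assume "N \<le> m" "N \<le> n"
      then show "dist (u m) (u n) < e"
        using near[of m] near[of n] by (metis dist_triangle_half_l)
    qed
  qed
  then obtain v where v: "u \<longlonglongrightarrow> v" using Cauchy_convergent convergent_def by blast
  have vK: "v \<in> K" using K(1) u(1) v by (metis closed_sequentially)
  have "(\<lambda>n. \<phi> (u n)) \<longlonglongrightarrow> \<phi> v"
    using continuous_on_tendsto_compose[OF cont v vK] u(1) by (simp add: eventually_sequentially)
  then have Lv: "L = \<phi> v" using L(1) LIMSEQ_unique by blast
  have desc_v: "\<phi> v + c * dist v (u n) \<le> \<phi> (u n)" for n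
  proof (rule LIMSEQ_le_const2)
    show "(\<lambda>m. \<phi> (u m) + c * dist (u m) (u n)) \<longlonglongrightarrow> \<phi> v + c * dist v (u n)"
      using L(1) unfolding Lv by (intro tendsto_intros v)
    show "\<exists>N. \<forall>m\<ge>N. \<phi> (u m) + c * dist (u m) (u n) \<le> \<phi> (u n)"
      using desc by blast
  qed
  show thesis
  proof (rule that[of v])
    show "\<phi> v + c * dist v u0 \<le> \<phi> u0" using desc_v[of 0] u(2) by simp
    fix w assume w: "w \<in> K"
    show "\<phi> v \<le> \<phi> w + c * dist w v"
    proof (rule ccontr)
      assume "\<not> ?thesis"
      then have less: "\<phi> w + c * dist w v < \<phi> v" by simp
      have "w \<in> S (u n)" for n
      proof -
        have "c * dist w (u n) \<le> c * dist w v + c * dist v (u n)"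
          using c dist_triangle[of w "u n" v] by (simp flip: distrib_left)
        then show ?thesis using w less desc_v[of n] by (simp add: S_def)
      qed
      then have "\<phi> (u (Suc n)) \<le> (\<phi> (u n) + \<phi> w) / 2" for n by (rule u(4))
      then have "\<phi> v \<le> (\<phi> (u n) + \<phi> w) / 2" for n
        using L(2)[of "Suc n"] Lv order_trans by metis
      moreover have "(\<lambda>n. (\<phi> (u n) + \<phi> w) / 2) \<longlonglongrightarrow> (\<phi> v + \<phi> w) / 2"
        using L(1) unfolding Lv by (intro tendsto_intros) auto
      ultimately have "\<phi> v \<le> (\<phi> v + \<phi> w) / 2" by (intro LIMSEQ_le_const) auto
      then have "\<phi> v \<le> \<phi> w" by simp
      moreover have "0 \<le> c * dist w v" using c by simp
      ultimately show False using less by linarith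
    qed
  qed (rule vK)
qed

section \<open>Epsilon-normals\<close>

text \<open>
  The base point satisfies the inequality trivially, so it need not be excluded, and isolated
  points need no separate treatment.
\<close>

lemma eps_normals_iff:
  "f \<in> eps_normals \<epsilon> x \<Omega> \<longleftrightarrow>
     (\<forall>\<gamma>>0. \<exists>\<delta>>0. \<forall>u\<in>\<Omega>. dist u x < \<delta> \<longrightarrow> blinfun_apply f (u - x) \<le> (\<epsilon> + \<gamma>) * norm (u - x))"
  (is "?L \<longleftrightarrow> ?R")
proof -
  let ?q = "\<lambda>u. blinfun_apply f (u - x) / norm (u - x)"
  have L: "?L \<longleftrightarrow> (\<forall>y>ereal \<epsilon>. \<forall>\<^sub>F u in at x within \<Omega>. ereal (?q u) < y)"
    by (simp add: eps_normals_def Limsup_le_iff)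
  show ?thesis
  proof
    assume ?L
    show ?R
    proof (intro allI impI)
      fix \<gamma> :: real assume "\<gamma> > 0"
      then have "ereal \<epsilon> < ereal (\<epsilon> + \<gamma>)" by simp
      then have "\<forall>\<^sub>F u in at x within \<Omega>. ereal (?q u) < ereal (\<epsilon> + \<gamma>)"
        using \<open>?L\<close> L by blast
      then obtain \<delta> where \<delta>: "\<delta> > 0"
        "\<And>u. u \<in> \<Omega> \<Longrightarrow> u \<noteq> x \<Longrightarrow> dist u x < \<delta> \<Longrightarrow> ?q u < \<epsilon> + \<gamma>"
        by (auto simp: eventually_at)
      show "\<exists>\<delta>>0. \<forall>u\<in>\<Omega>. dist u x < \<delta> \<longrightarrow> blinfun_apply f (u - x) \<le> (\<epsilon> + \<gamma>) * norm (u - x)"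
      proof (intro exI[of _ \<delta>] conjI ballI impI)
        fix u assume u: "u \<in> \<Omega>" "dist u x < \<delta>"
        show "blinfun_apply f (u - x) \<le> (\<epsilon> + \<gamma>) * norm (u - x)"
        proof (cases "u = x")
          case False
          then show ?thesis using \<delta>(2)[OF u(1) False u(2)] by (simp add: divide_less_eq)
        qed simp
      qed (rule \<delta>(1))
    qed
  next
    assume R: ?R
    show ?L
      unfolding L
    proof (intro allI impI)
      fix y assume "ereal \<epsilon> < y"
      then obtain z where z: "\<epsilon> < z" "ereal z < y" using ereal_dense2[of "ereal \<epsilon>" y] by auto
      then obtain \<delta> where \<delta>: "\<delta> > 0"
        "\<And>u. u \<in> \<Omega> \<Longrightarrow> dist u x < \<delta> \<Longrightarrow> blinfun_apply f (u - x) \<le> (\<epsilon> + (z - \<epsilon>)) * norm (u - x)"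
        using R[rule_format, of "z - \<epsilon>"] by auto
      have "ereal (?q u) < y" if "u \<in> \<Omega>" "u \<noteq> x" "dist u x < \<delta>" for u
      proof -
        have "?q u \<le> z" using \<delta>(2)[OF that(1,3)] that(2) by (simp add: divide_le_eq)
        then show ?thesis using z(2) by (metis ereal_less_eq(3) order_le_less_trans)
      qed
      then show "\<forall>\<^sub>F u in at x within \<Omega>. ereal (?q u) < y"
        using \<delta>(1) by (auto simp: eventually_at)
    qed
  qed
qed

lemma eps_normalsI:
  assumes "\<delta> > 0" and "\<And>u. u \<in> \<Omega> \<Longrightarrow> dist u x < \<delta> \<Longrightarrow> blinfun_apply f (u - x) \<le> \<epsilon> * norm (u - x)"
  shows "f \<in> eps_normals \<epsilon> x \<Omega>"
  unfolding eps_normals_iff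
proof (intro allI impI exI[of _ \<delta>] conjI ballI)
  fix \<gamma> :: real and u assume *: "\<gamma> > 0" "u \<in> \<Omega>" "dist u x < \<delta>"
  have "\<epsilon> * norm (u - x) \<le> (\<epsilon> + \<gamma>) * norm (u - x)"
    using *(1) by (intro mult_right_mono) auto
  then show "blinfun_apply f (u - x) \<le> (\<epsilon> + \<gamma>) * norm (u - x)"
    using assms(2)[OF *(2,3)] by linarith
qed (rule assms(1))

lemma eps_normals_scale:
  assumes "f \<in> eps_normals \<epsilon> x \<Omega>" and "c > 0"
  shows "c *\<^sub>R f \<in> eps_normals (c * \<epsilon>) x \<Omega>"
  unfolding eps_normals_iff
proof (intro allI impI)
  fix \<gamma> :: real assume "\<gamma> > 0"
  then have "\<gamma> / c > 0" using assms(2) by simp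
  then obtain \<delta> where \<delta>: "\<delta> > 0"
    "\<And>u. u \<in> \<Omega> \<Longrightarrow> dist u x < \<delta> \<Longrightarrow> blinfun_apply f (u - x) \<le> (\<epsilon> + \<gamma> / c) * norm (u - x)"
    using assms(1) unfolding eps_normals_iff by blast
  have "blinfun_apply (c *\<^sub>R f) (u - x) \<le> (c * \<epsilon> + \<gamma>) * norm (u - x)"
    if "u \<in> \<Omega>" "dist u x < \<delta>" for u
  proof -
    have "c * blinfun_apply f (u - x) \<le> c * ((\<epsilon> + \<gamma> / c) * norm (u - x))"
      using \<delta>(2)[OF that] assms(2) by simp
    also have "\<dots> = (c * \<epsilon> + \<gamma>) * norm (u - x)" using assms(2) by (simp add: field_simps)
    finally show ?thesis by (simp add: blinfun.scaleR_left)
  qed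
  then show "\<exists>\<delta>>0. \<forall>u\<in>\<Omega>. dist u x < \<delta> \<longrightarrow>
      blinfun_apply (c *\<^sub>R f) (u - x) \<le> (c * \<epsilon> + \<gamma>) * norm (u - x)"
    using \<delta>(1) by blast
qed

lemma eps_normals_perturb:
  assumes "f \<in> eps_normals \<epsilon> x \<Omega>" and "norm (g - f) \<le> e" and "\<epsilon> + e \<le> \<epsilon>'"
  shows "g \<in> eps_normals \<epsilon>' x \<Omega>"
  unfolding eps_normals_iff
proof (intro allI impI)
  fix \<gamma> :: real assume "\<gamma> > 0"
  then obtain \<delta> where \<delta>: "\<delta> > 0"
    "\<And>u. u \<in> \<Omega> \<Longrightarrow> dist u x < \<delta> \<Longrightarrow> blinfun_apply f (u - x) \<le> (\<epsilon> + \<gamma>) * norm (u - x)"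
    using assms(1) unfolding eps_normals_iff by blast
  have "blinfun_apply g (u - x) \<le> (\<epsilon>' + \<gamma>) * norm (u - x)"
    if "u \<in> \<Omega>" "dist u x < \<delta>" for u
  proof -
    have "blinfun_apply (g - f) (u - x) \<le> norm (g - f) * norm (u - x)"
      using norm_blinfun[of "g - f" "u - x"] by simp
    also have "\<dots> \<le> e * norm (u - x)" using assms(2) by (simp add: mult_right_mono)
    finally have "blinfun_apply g (u - x) \<le> (\<epsilon> + \<gamma> + e) * norm (u - x)"
      using \<delta>(2)[OF that] by (simp add: blinfun.diff_left distrib_right)
    also have "\<dots> \<le> (\<epsilon>' + \<gamma>) * norm (u - x)"
      using assms(3) by (intro mult_right_mono) auto
    finally show ?thesis .
  qed
  then show "\<exists>\<delta>>0. \<forall>u\<in>\<Omega>. dist u x < \<delta> \<longrightarrow>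
      blinfun_apply g (u - x) \<le> (\<epsilon>' + \<gamma>) * norm (u - x)"
    using \<delta>(1) by blast
qed

lemma dual_pair_apply [simp]:
  "blinfun_apply (dual_pair f g) u = blinfun_apply f (fst u) + blinfun_apply g (snd u)"
  by (simp add: dual_pair_def blinfun.add_left snd_blinfun.rep_eq)

lemma norm_dual_pair_le: "norm (dual_pair f g) \<le> norm f + norm g"
proof (rule norm_blinfun_bound)
  fix u
  have "norm (blinfun_apply (dual_pair f g) u) \<le> norm f * norm (fst u) + norm g * norm (snd u)"
    using norm_blinfun[of f "fst u"] norm_blinfun[of g "snd u"] by simp
  also have "\<dots> \<le> norm f * norm u + norm g * norm u"
    using norm_fst_le[of "fst u" "snd u"] norm_snd_le[of "snd u" "fst u"]
    by (intro add_mono mult_left_mono) auto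
  finally show "norm (blinfun_apply (dual_pair f g) u) \<le> (norm f + norm g) * norm u"
    by (simp add: distrib_right)
qed simp

lemma dual_pair_diff: "dual_pair f g - dual_pair f' g' = dual_pair (f - f') (g - g')"
  by (rule blinfun_eqI) (simp add: blinfun.diff_left)

lemma dual_pair_scale: "c *\<^sub>R dual_pair f g = dual_pair (c *\<^sub>R f) (c *\<^sub>R g)"
  by (rule blinfun_eqI) (simp add: blinfun.scaleR_left distrib_left)

section \<open>Duality images of contingent cones of convex sets\<close>

lemma zero_in_contingent_cone: "x \<in> \<Omega> \<Longrightarrow> 0 \<in> contingent_cone x \<Omega>"
  unfolding contingent_cone_def mem_Collect_eq down_to_zero_def
  by (rule exI[of _ "\<lambda>n. inverse (real (Suc n))"], rule exI[of _ "\<lambda>_. 0"])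
    (use LIMSEQ_inverse_real_of_nat in simp)

lemma contingent_cone_UNIV: "contingent_cone x UNIV = UNIV"
proof -
  have "v \<in> contingent_cone x UNIV" for v
    unfolding contingent_cone_def mem_Collect_eq down_to_zero_def
    by (rule exI[of _ "\<lambda>n. inverse (real (Suc n))"], rule exI[of _ "\<lambda>_. v"])
      (use LIMSEQ_inverse_real_of_nat in simp)
  then show ?thesis by auto
qed

text \<open>
  Without a constraint the requirement \<open>f \<in> J(T(x; \<Omega>))\<close> in the coderivatives is void.
\<close>

lemma duality_image_UNIV:
  assumes "reflexive_space TYPE('a::real_normed_vector)"
  shows "duality_image (contingent_cone (x::'a) UNIV) = UNIV"
  unfolding contingent_cone_UNIV duality_image_def using duality_map_surj[OF assms] by blast

lemma duality_image_scale:
  assumes "f \<in> duality_image (contingent_cone x \<Omega>)" and "x \<in> \<Omega>" and "\<beta> \<ge> 0"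
  shows "\<beta> *\<^sub>R f \<in> duality_image (contingent_cone x \<Omega>)"
proof -
  obtain v where v: "v \<in> contingent_cone x \<Omega>" "f \<in> duality_map v"
    using assms(1) by (auto simp: duality_image_def)
  have "\<beta> *\<^sub>R v \<in> contingent_cone x \<Omega>"
  proof (cases "\<beta> = 0")
    case False
    obtain t zs where t: "down_to_zero t" "zs \<longlonglongrightarrow> v" "\<And>k. x + t k *\<^sub>R zs k \<in> \<Omega>"
      using v(1) by (auto simp: contingent_cone_def)
    have "down_to_zero (\<lambda>k. t k / \<beta>)"
      using t(1) False assms(3) unfolding down_to_zero_def by (auto intro: tendsto_divide_zero)
    moreover have "(\<lambda>k. \<beta> *\<^sub>R zs k) \<longlonglongrightarrow> \<beta> *\<^sub>R v" by (intro tendsto_intros t)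
    moreover have "x + (t k / \<beta>) *\<^sub>R (\<beta> *\<^sub>R zs k) \<in> \<Omega>" for k using t(3) False by simp
    ultimately show ?thesis unfolding contingent_cone_def by blast
  qed (use zero_in_contingent_cone assms in auto)
  then show ?thesis
    using duality_map_scale[OF v(2)] by (auto simp: duality_image_def)
qed

lemma duality_map_continuous_eps:
  fixes w :: "'a::real_normed_vector"
  assumes luc: "locally_uniformly_convex TYPE('a \<Rightarrow>\<^sub>L real)"
    and j: "j \<in> duality_map w" and e: "e > 0"
  obtains \<delta> where "\<delta> > 0" "\<And>w' j'. dist w' w < \<delta> \<Longrightarrow> j' \<in> duality_map w' \<Longrightarrow> norm (j' - j) < e"
proof (rule ccontr)
  assume *: "\<not> thesis"
  have "\<exists>w' j'. dist w' w < inverse (real (Suc n)) \<and> j' \<in> duality_map w' \<and> \<not> norm (j' - j) < e" for n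
    using * that[of "inverse (real (Suc n))"] by fastforce
  then obtain wn jn where wn: "\<And>n. dist (wn n) w < inverse (real (Suc n))"
    and jn: "\<And>n. jn n \<in> duality_map (wn n)" "\<And>n. \<not> norm (jn n - j) < e"
    by metis
  have "(\<lambda>n. dist (wn n) w) \<longlonglongrightarrow> 0"
    by (rule tendsto_sandwich[OF _ _ tendsto_const LIMSEQ_inverse_real_of_nat])
      (use wn in \<open>auto intro: less_imp_le always_eventually\<close>)
  then have "wn \<longlonglongrightarrow> w" by (rule tendsto_dist_iff[THEN iffD2])
  then have "jn \<longlonglongrightarrow> j" by (intro duality_map_continuous[OF luc j, of jn wn] jn(1))
  then have "\<forall>\<^sub>F n in sequentially. dist (jn n) j < e" using e by (rule tendstoD)
  then show False using jn(2) by (auto simp: dist_norm eventually_sequentially)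
qed

text \<open>
  A tangent direction at \<open>x\<close> is nearly of the form \<open>(z - x) / T\<close> with \<open>z \<in> \<Omega>\<close>, and by convexity
  \<open>(z - x') / T\<close> is then tangent at every \<open>x' \<in> \<Omega>\<close>.
\<close>

lemma contingent_cone_lsc:
  fixes \<Omega> :: "'a::real_normed_vector set"
  assumes cvx: "convex \<Omega>" and v: "v \<in> contingent_cone x \<Omega>" and e: "e > 0"
  obtains \<delta> where "\<delta> > 0"
    "\<And>x'. x' \<in> \<Omega> \<Longrightarrow> dist x' x < \<delta> \<Longrightarrow> \<exists>v'\<in>contingent_cone x' \<Omega>. dist v' v < e"
proof -
  obtain t zs where t: "down_to_zero t" "zs \<longlonglongrightarrow> v" "\<And>k. x + t k *\<^sub>R zs k \<in> \<Omega>"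
    using v by (auto simp: contingent_cone_def)
  have "\<forall>\<^sub>F k in sequentially. dist (zs k) v < e / 2" using e by (intro tendstoD[OF t(2)]) simp
  then obtain k where k: "dist (zs k) v < e / 2" by (auto simp: eventually_sequentially)
  define T where "T = t k"
  define z where "z = x + T *\<^sub>R zs k"
  have T: "T > 0" using t(1) by (simp add: T_def down_to_zero_def)
  have z: "z \<in> \<Omega>" using t(3) by (simp add: z_def T_def)
  show thesis
  proof (rule that[of "T * e / 2"])
    show "T * e / 2 > 0" using T e by simp
    fix x' assume x': "x' \<in> \<Omega>" "dist x' x < T * e / 2"
    define v' where "v' = (1 / T) *\<^sub>R (z - x')"
    have "v' \<in> contingent_cone x' \<Omega>"
    proof -
      define s where "s n = T * inverse (real (Suc n))" for n
      have "down_to_zero s"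
        unfolding down_to_zero_def s_def
        using T LIMSEQ_inverse_real_of_nat by (auto intro!: tendsto_mult_right_zero)
      moreover have "x' + s n *\<^sub>R v' \<in> \<Omega>" for n
      proof -
        have "(1 - inverse (real (Suc n))) *\<^sub>R x' + inverse (real (Suc n)) *\<^sub>R z \<in> \<Omega>"
          by (rule convexD[OF cvx x'(1) z]) (auto simp: field_simps)
        moreover have "s n *\<^sub>R v' = inverse (real (Suc n)) *\<^sub>R (z - x')"
          using T by (simp add: s_def v'_def)
        then have "x' + s n *\<^sub>R v' = (1 - inverse (real (Suc n))) *\<^sub>R x' + inverse (real (Suc n)) *\<^sub>R z"
          by (simp only: scaleR_diff_left scaleR_diff_right scaleR_one) simp
        ultimately show ?thesis by simp
      qed
      ultimately show ?thesis
        unfolding contingent_cone_def by (auto intro!: exI[of _ s] exI[of _ "\<lambda>_. v'"])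
    qed
    moreover have "dist v' v < e"
    proof -
      have "v' = zs k + (1 / T) *\<^sub>R (x - x')"
        using T by (simp add: v'_def z_def algebra_simps)
      then have "dist v' (zs k) = dist x' x / T"
        using T by (simp add: dist_norm norm_minus_commute)
      also have "\<dots> < e / 2" using x'(2) T by (simp add: field_simps)
      finally show ?thesis using k dist_triangle_half_r by (metis dist_commute)
    qed
    ultimately show "\<exists>v'\<in>contingent_cone x' \<Omega>. dist v' v < e" by blast
  qed
qed

lemma duality_image_lsc:
  fixes \<Omega> :: "'a::real_normed_vector set"
  assumes luc: "locally_uniformly_convex TYPE('a \<Rightarrow>\<^sub>L real)" and cvx: "convex \<Omega>"
    and f: "f \<in> duality_image (contingent_cone x \<Omega>)" and e: "e > 0"
  obtains \<delta> where "\<delta> > 0"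
    "\<And>x'. x' \<in> \<Omega> \<Longrightarrow> dist x' x < \<delta> \<Longrightarrow> \<exists>f'\<in>duality_image (contingent_cone x' \<Omega>). norm (f' - f) < e"
proof -
  obtain v where v: "v \<in> contingent_cone x \<Omega>" "f \<in> duality_map v"
    using f by (auto simp: duality_image_def)
  obtain d where d: "d > 0" "\<And>w' j'. dist w' v < d \<Longrightarrow> j' \<in> duality_map w' \<Longrightarrow> norm (j' - f) < e"
    using duality_map_continuous_eps[OF luc v(2) e] by metis
  obtain \<delta> where \<delta>: "\<delta> > 0"
    "\<And>x'. x' \<in> \<Omega> \<Longrightarrow> dist x' x < \<delta> \<Longrightarrow> \<exists>v'\<in>contingent_cone x' \<Omega>. dist v' v < d"
    using contingent_cone_lsc[OF cvx v(1) d(1)] by metis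
  show thesis
  proof (rule that[OF \<delta>(1)])
    fix x' assume "x' \<in> \<Omega>" "dist x' x < \<delta>"
    then obtain v' where v': "v' \<in> contingent_cone x' \<Omega>" "dist v' v < d" using \<delta>(2) by blast
    obtain j' where j': "j' \<in> duality_map v'" by (rule duality_map_nonempty)
    show "\<exists>f'\<in>duality_image (contingent_cone x' \<Omega>). norm (f' - f) < e"
      using d(2)[OF v'(2) j'] j' v'(1) by (auto simp: duality_image_def)
  qed
qed

section \<open>Splitting normals to a composed graph\<close>

text \<open>
  The upper half of the Frechet differentiability of \<open>w \<mapsto> (norm w)\<^sup>2\<close>, with derivative \<open>2 j\<close>: by
  convexity \<open>(norm w')\<^sup>2 - (norm w)\<^sup>2 \<le> 2 \<langle>j', w' - w\<rangle>\<close> for \<open>j' \<in> J(w')\<close>, and \<open>j'\<close> is close to \<open>j\<close>.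
\<close>

lemma norm_square_upper_expansion:
  fixes w :: "'a::real_normed_vector"
  assumes luc: "locally_uniformly_convex TYPE('a \<Rightarrow>\<^sub>L real)"
    and j: "j \<in> duality_map w" and e: "e > 0"
  obtains \<delta> where "\<delta> > 0" "\<And>w'. dist w' w < \<delta> \<Longrightarrow>
    (norm w')\<^sup>2 \<le> (norm w)\<^sup>2 + 2 * blinfun_apply j (w' - w) + e * norm (w' - w)"
proof -
  obtain \<delta> where \<delta>: "\<delta> > 0"
    "\<And>w' j'. dist w' w < \<delta> \<Longrightarrow> j' \<in> duality_map w' \<Longrightarrow> norm (j' - j) < e / 2"
    using duality_map_continuous_eps[OF luc j, of "e / 2"] e by (metis half_gt_zero)
  show thesis
  proof (rule that[OF \<delta>(1)])
    fix w' assume w': "dist w' w < \<delta>"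
    obtain j' where j': "j' \<in> duality_map w'" by (rule duality_map_nonempty)
    have "blinfun_apply j' w \<le> norm w' * norm w"
      using norm_blinfun[of j' w] j' by (simp add: duality_map_def)
    also have "2 * (norm w' * norm w) \<le> (norm w')\<^sup>2 + (norm w)\<^sup>2"
      using sum_squares_bound[of "norm w'" "norm w"] by simp
    finally have "(norm w')\<^sup>2 - (norm w)\<^sup>2 \<le> 2 * blinfun_apply j' (w' - w)"
      using j' by (simp add: duality_map_def blinfun.diff_right)
    also have "\<dots> = 2 * blinfun_apply j (w' - w) + 2 * blinfun_apply (j' - j) (w' - w)"
      by (simp add: blinfun.diff_left)
    also have "blinfun_apply (j' - j) (w' - w) \<le> norm (j' - j) * norm (w' - w)"
      using norm_blinfun[of "j' - j" "w' - w"] by simp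
    also have "\<dots> \<le> e / 2 * norm (w' - w)"
      using \<delta>(2)[OF w' j'] by (intro mult_right_mono) auto
    finally show "(norm w')\<^sup>2 \<le> (norm w)\<^sup>2 + 2 * blinfun_apply j (w' - w) + e * norm (w' - w)"
      by simp
  qed
qed

lemma square_pos_part_upper:
  fixes s t :: real
  shows "(max 0 t)\<^sup>2 \<le> (max 0 s)\<^sup>2 + 2 * max 0 s * (t - s) + (t - s)\<^sup>2"
proof -
  have "0 \<le> (t - s)\<^sup>2" by simp
  consider "t \<ge> 0" "s \<ge> 0" | "t \<ge> 0" "s \<le> 0" | "t \<le> 0" "s \<ge> 0" | "t \<le> 0" "s \<le> 0" by linarith
  then show ?thesis
  proof cases
    case 1 then show ?thesis by (simp add: max_def power2_eq_square algebra_simps)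
  next
    case 2
    then have "t\<^sup>2 \<le> (t - s)\<^sup>2" by (intro power_mono) auto
    then show ?thesis using 2 by (simp add: max_def)
  next
    case 3
    have "s\<^sup>2 + 2 * s * (t - s) + (t - s)\<^sup>2 = t\<^sup>2" by (simp add: power2_eq_square algebra_simps)
    then show ?thesis using 3 by (simp add: max_def)
  next
    case 4 then show ?thesis by (simp add: max_def)
  qed
qed

text \<open>
  A normal to the composed graph splits, up to small errors, into normals to the two factors that
  share the component \<open>j\<close> and carry a common multiplier \<open>\<beta>\<close>. The multiplier may vanish; the
  normalisation guarantees that \<open>\<beta>\<close> and \<open>j\<close> are not both small.
\<close>

lemma fuzzy_decoupling:
  fixes A :: "('x::banach \<times> 'y::banach) set" and B :: "('y \<times> 'z::banach) set"
  assumes luc: "locally_uniformly_convex TYPE('y \<Rightarrow>\<^sub>L real)"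
    and A: "(x0, y0) \<in> A" "(x0, y0) \<in> interior CA" "closed CA" "closed (A \<inter> CA)"
    and B: "(y0, z0) \<in> B" "(y0, z0) \<in> interior CB" "closed CB" "closed (B \<inter> CB)"
    and normal: "dual_pair xs (- zs) \<in> eps_normals \<epsilon> (x0, z0) {(x, z). \<exists>y. (x, y) \<in> A \<and> (y, z) \<in> B}"
    and \<epsilon>: "\<epsilon> \<ge> 0" and \<eta>: "\<eta> > 0"
  obtains x1 y1 y2 z2 \<beta> j where "(x1, y1) \<in> A" "(y2, z2) \<in> B"
    "dist (x1, y1) (x0, y0) < \<eta>" "dist (y2, z2) (y0, z0) < \<eta>"
    "\<beta> \<ge> 0" "\<beta>\<^sup>2 + (norm j)\<^sup>2 = 1"
    "dual_pair (\<beta> *\<^sub>R xs) (- j) \<in> eps_normals (\<epsilon> + \<eta>) (x1, y1) A"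
    "dual_pair j (- (\<beta> *\<^sub>R zs)) \<in> eps_normals (\<epsilon> + \<eta>) (y2, z2) B"
proof -
  define \<gamma> where "\<gamma> = \<eta> / 3"
  have \<gamma>: "\<gamma> > 0" using \<eta> by (simp add: \<gamma>_def)
  obtain \<delta> where \<delta>: "\<delta> > 0" and normal': "\<And>x y z. (x, y) \<in> A \<Longrightarrow> (y, z) \<in> B \<Longrightarrow>
      dist (x, z) (x0, z0) < \<delta> \<Longrightarrow> blinfun_apply xs (x - x0) - blinfun_apply zs (z - z0)
        \<le> (\<epsilon> + \<gamma>) * norm (x - x0, z - z0)"
  proof -
    obtain \<delta> where \<delta>: "\<delta> > 0" and *: "\<And>u. u \<in> {(x, z). \<exists>y. (x, y) \<in> A \<and> (y, z) \<in> B} \<Longrightarrow>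
        dist u (x0, z0) < \<delta> \<Longrightarrow> blinfun_apply (dual_pair xs (- zs)) (u - (x0, z0))
          \<le> (\<epsilon> + \<gamma>) * norm (u - (x0, z0))"
      using normal[unfolded eps_normals_iff, THEN spec, THEN mp, OF \<gamma>] by blast
    show thesis
    proof (rule that[OF \<delta>])
      fix x y z assume "(x, y) \<in> A" "(y, z) \<in> B" "dist (x, z) (x0, z0) < \<delta>"
      then show "blinfun_apply xs (x - x0) - blinfun_apply zs (z - z0)
          \<le> (\<epsilon> + \<gamma>) * norm (x - x0, z - z0)"
        using *[of "(x, z)"] by (auto simp: blinfun.minus_left)
    qed
  qed
  obtain \<rho>A where \<rho>A: "\<rho>A > 0" "cball (x0, y0) \<rho>A \<subseteq> CA" using A(2) by (metis mem_interior_cball)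
  obtain \<rho>B where \<rho>B: "\<rho>B > 0" "cball (y0, z0) \<rho>B \<subseteq> CB" using B(2) by (metis mem_interior_cball)
  define \<rho> where "\<rho> = min (min \<rho>A \<rho>B) (\<delta> / 3)"
  have \<rho>: "\<rho> > 0" "\<rho> \<le> \<rho>A" "\<rho> \<le> \<rho>B" "2 * \<rho> < \<delta>" using \<rho>A \<rho>B \<delta> by (auto simp: \<rho>_def)
  define \<sigma> where "\<sigma> = min (\<rho> / 2) (\<eta> / 3)"
  have \<sigma>: "\<sigma> > 0" "\<sigma> \<le> \<rho> / 2" "\<sigma> \<le> \<eta> / 3" using \<rho> \<eta> by (auto simp: \<sigma>_def)
  define KA where "KA = A \<inter> cball (x0, y0) \<rho>"
  define KB where "KB = B \<inter> cball (y0, z0) \<rho>"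
  have "KA = (A \<inter> CA) \<inter> cball (x0, y0) \<rho>" "KB = (B \<inter> CB) \<inter> cball (y0, z0) \<rho>"
    using \<rho>A \<rho>B \<rho> by (auto simp: KA_def KB_def subset_iff)
  then have closed: "closed KA" "closed KB" using A(4) B(4) by (auto intro: closed_Int)
  define h where "h x z = blinfun_apply xs (x - x0) - blinfun_apply zs (z - z0)
      - (\<epsilon> + \<gamma>) * norm (x - x0, z - z0)" for x z
  define s where "s x z = \<sigma>\<^sup>2 - h x z" for x z
  define \<phi> where "\<phi> u = norm (snd (fst u) - fst (snd u), max 0 (s (fst (fst u)) (snd (snd u))))"
    for u :: "('x \<times> 'y) \<times> ('y \<times> 'z)"
  have \<phi>_pair: "\<phi> ((x, y), (y', z)) = norm (y - y', max 0 (s x z))" for x y y' z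
    by (simp add: \<phi>_def)
  let ?u0 = "((x0, y0), (y0, z0))"
  \<comment> \<open>on the diagonal \<open>y = y'\<close> the point \<open>(x, z)\<close> lies in the composed graph, where \<open>h \<le> 0\<close>\<close>
  have s_pos: "0 < s x z" if "(x, y) \<in> KA" "(y, z) \<in> KB" for x y z
  proof -
    have "dist x x0 \<le> \<rho>" "dist z z0 \<le> \<rho>"
      using that dist_fst_le[of "(x, y)" "(x0, y0)"] dist_snd_le[of "(y, z)" "(y0, z0)"]
      by (auto simp: KA_def KB_def dist_commute)
    then have "dist (x, z) (x0, z0) < \<delta>"
      using norm_Pair_le[of "x - x0" "z - z0"] \<rho>(4) by (simp add: dist_norm)
    then have "h x z \<le> 0"
      using normal'[of x y z] that by (simp add: h_def KA_def KB_def)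
    moreover have "0 < \<sigma>\<^sup>2" using \<sigma> by simp
    ultimately show ?thesis unfolding s_def by linarith
  qed
  have \<phi>_pos: "\<phi> u > 0" if "u \<in> KA \<times> KB" for u
  proof -
    obtain x y y' z where u: "u = ((x, y), (y', z))" by (metis prod.collapse)
    show ?thesis
    proof (cases "y = y'")
      case True
      then have "s x z > 0" using s_pos[of x y z] that by (auto simp: u)
      then show ?thesis unfolding u \<phi>_pair by (simp add: prod_eq_iff zero_prod_def)
    next
      case False
      then show ?thesis unfolding u \<phi>_pair by (simp add: prod_eq_iff zero_prod_def)
    qed
  qed
  have cont: "continuous_on (KA \<times> KB) \<phi>"
    unfolding \<phi>_def s_def h_def by (intro continuous_intros)
  have u0: "?u0 \<in> KA \<times> KB" using A(1) B(1) \<rho>(1) by (simp add: KA_def KB_def)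
  obtain v where v: "v \<in> KA \<times> KB" "\<phi> v + \<sigma> * dist v ?u0 \<le> \<phi> ?u0"
    and min: "\<And>u. u \<in> KA \<times> KB \<Longrightarrow> \<phi> v \<le> \<phi> u + \<sigma> * dist u v"
  proof (rule Ekeland[of "KA \<times> KB" ?u0 \<phi> \<sigma>])
    show "closed (KA \<times> KB)" using closed by (rule closed_Times)
    show "0 \<le> \<phi> u" for u by (simp add: \<phi>_def)
  qed (use u0 cont \<sigma>(1) in blast)+
  define r where "r = \<phi> v"
  have r: "r > 0" using \<phi>_pos[OF v(1)] by (simp add: r_def)
  have "\<sigma> * dist v ?u0 < \<sigma> * \<sigma>"
    using v(2) r by (simp add: \<phi>_pair s_def h_def r_def power2_eq_square)
  then have dv: "dist v ?u0 < \<sigma>" using \<sigma>(1) by simp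
  obtain x1 y1 y2 z2 where v_eq: "v = ((x1, y1), (y2, z2))" by (metis prod.collapse)
  have d1: "dist (x1, y1) (x0, y0) < \<sigma>" and d2: "dist (y2, z2) (y0, z0) < \<sigma>"
    using dv dist_fst_le[of v ?u0] dist_snd_le[of v ?u0] by (auto simp: v_eq)
  define w where "w = y1 - y2"
  define s1 where "s1 = max 0 (s x1 z2)"
  obtain J where J: "J \<in> duality_map w" by (rule duality_map_nonempty)
  have r2: "r\<^sup>2 = (norm w)\<^sup>2 + s1\<^sup>2"
    by (simp add: r_def v_eq \<phi>_pair w_def s1_def norm_Pair)
  define \<beta> where "\<beta> = s1 / r"
  define j where "j = (1 / r) *\<^sub>R J"
  have "s1 \<ge> 0" by (simp add: s1_def)
  then have \<beta>0: "\<beta> \<ge> 0" using r by (simp add: \<beta>_def)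
  have norm1: "\<beta>\<^sup>2 + (norm j)\<^sup>2 = 1"
  proof -
    have "norm J = norm w" using J by (simp add: duality_map_def)
    then have "\<beta>\<^sup>2 + (norm j)\<^sup>2 = (s1\<^sup>2 + (norm w)\<^sup>2) / r\<^sup>2"
      using r by (simp add: \<beta>_def j_def power_divide add_divide_distrib)
    also have "s1\<^sup>2 + (norm w)\<^sup>2 = r\<^sup>2" using r2 by simp
    finally show ?thesis using r by simp
  qed
  have \<beta>1: "\<beta> \<le> 1"
    using norm1 by (intro power2_le_imp_le[of \<beta> 1]) (auto, smt (verit) zero_le_power2)
  define L where "L = norm xs + norm zs + \<epsilon> + \<gamma>"
  have L: "L > 0" using \<gamma> \<epsilon> by (simp add: L_def add_nonneg_pos)
  obtain \<delta>1 where \<delta>1: "\<delta>1 > 0" and exp: "\<And>w'. dist w' w < \<delta>1 \<Longrightarrow>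
      (norm w')\<^sup>2 \<le> (norm w)\<^sup>2 + 2 * blinfun_apply J (w' - w) + r * \<eta> / 6 * norm (w' - w)"
    using norm_square_upper_expansion[OF luc J, of "r * \<eta> / 6"] r \<eta> by (metis divide_pos_pos mult_pos_pos zero_less_numeral)
  \<comment> \<open>the three bounds control the expansion of the norm, the sign of \<open>r - \<sigma> d\<close> and the quadratic error\<close>
  define \<delta>2 where "\<delta>2 = min (\<delta>1 / 2) (min (r / \<sigma>) (r * \<eta> / (3 * L\<^sup>2)))"
  have \<delta>2: "\<delta>2 > 0" using \<delta>1 r \<sigma> \<eta> L by (simp add: \<delta>2_def)
  have key: "\<beta> * (blinfun_apply xs (x - x1) - blinfun_apply zs (z - z2))
      - blinfun_apply j (y - y1) + blinfun_apply j (y' - y2) \<le> (\<epsilon> + \<eta>) * d"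
    if K: "(x, y) \<in> KA" "(y', z) \<in> KB" and d: "d = dist ((x, y), (y', z)) v" "d < \<delta>2"
    for x y y' z d
  proof -
    have d0: "d \<ge> 0" using d by simp
    \<comment> \<open>squaring the Ekeland inequality makes the leading terms smooth\<close>
    have "\<phi> v \<le> \<phi> ((x, y), (y', z)) + \<sigma> * d" using min K d(1) by simp
    then have "r - \<sigma> * d \<le> \<phi> ((x, y), (y', z))" by (simp add: r_def)
    moreover have "0 \<le> r - \<sigma> * d"
    proof -
      have "d < r / \<sigma>" using d(2) by (simp add: \<delta>2_def)
      then show ?thesis using \<sigma>(1) by (simp add: field_simps)
    qed
    ultimately have "(r - \<sigma> * d)\<^sup>2 \<le> (\<phi> ((x, y), (y', z)))\<^sup>2" by (rule power_mono)
    also have "\<dots> = (norm (y - y'))\<^sup>2 + (max 0 (s x z))\<^sup>2"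
      by (simp add: \<phi>_pair norm_Pair)
    finally have "(r - \<sigma> * d)\<^sup>2 \<le> (norm (y - y'))\<^sup>2 + (max 0 (s x z))\<^sup>2" .
    moreover have "(r - \<sigma> * d)\<^sup>2 = r\<^sup>2 - 2 * r * \<sigma> * d + (\<sigma> * d)\<^sup>2"
      by (simp add: power2_diff mult.assoc)
    ultimately have 1: "r\<^sup>2 - 2 * r * \<sigma> * d \<le> (norm (y - y'))\<^sup>2 + (max 0 (s x z))\<^sup>2"
      using zero_le_power2[of "\<sigma> * d"] by linarith
    have dA: "dist (x, y) (x1, y1) \<le> d" and dB: "dist (y', z) (y2, z2) \<le> d"
      using dist_fst_le[of "((x, y), (y', z))" v] dist_snd_le[of "((x, y), (y', z))" v]
      by (auto simp: d(1) v_eq)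
    have dx: "norm (x - x1) \<le> d" and dy: "norm (y - y1) \<le> d"
      and dy': "norm (y' - y2) \<le> d" and dz: "norm (z - z2) \<le> d"
      using dA dB dist_fst_le[of "(x, y)" "(x1, y1)"] dist_snd_le[of "(x, y)" "(x1, y1)"]
        dist_fst_le[of "(y', z)" "(y2, z2)"] dist_snd_le[of "(y', z)" "(y2, z2)"]
      by (auto simp: dist_norm)
    have dxz: "norm (x - x1, z - z2) \<le> d"
    proof -
      have "norm (x - x1, z - z2) \<le> norm (((x, y), (y', z)) - v)"
        unfolding v_eq diff_Pair norm_Pair by (intro real_sqrt_le_mono) simp
      then show ?thesis by (simp add: d(1) dist_norm)
    qed
    have ww: "y - y' - w = (y - y1) - (y' - y2)" by (simp add: w_def)
    have nw: "norm (y - y' - w) \<le> 2 * d"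
      unfolding ww using norm_triangle_ineq4[of "y - y1" "y' - y2"] dy dy' by linarith
    have "dist (y - y') w < \<delta>1" using nw d(2) by (simp add: dist_norm \<delta>2_def)
    note exp[OF this]
    also have "r * \<eta> / 6 * norm (y - y' - w) \<le> r * \<eta> / 6 * (2 * d)"
      using nw r \<eta> by (intro mult_left_mono) auto
    also have "blinfun_apply J (y - y' - w) = blinfun_apply J (y - y1) - blinfun_apply J (y' - y2)"
      unfolding ww by (rule blinfun.diff_right)
    finally have 2: "(norm (y - y'))\<^sup>2
        \<le> (norm w)\<^sup>2 + 2 * (blinfun_apply J (y - y1) - blinfun_apply J (y' - y2)) + r * \<eta> / 3 * d"
      by (simp add: mult_ac)
    define D where "D = s x z - s x1 z2"
    define a where "a = blinfun_apply xs (x - x1) - blinfun_apply zs (z - z2)"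
    have 3: "(max 0 (s x z))\<^sup>2 \<le> s1\<^sup>2 + 2 * s1 * D + D\<^sup>2"
      unfolding s1_def D_def by (rule square_pos_part_upper)
    have D: "D = - a + (\<epsilon> + \<gamma>) * (norm (x - x0, z - z0) - norm (x1 - x0, z2 - z0))"
      by (simp add: D_def s_def h_def a_def blinfun.diff_right algebra_simps)
    have tri: "\<bar>norm (x - x0, z - z0) - norm (x1 - x0, z2 - z0)\<bar> \<le> norm (x - x1, z - z2)"
      using norm_triangle_ineq3[of "(x - x0, z - z0)" "(x1 - x0, z2 - z0)"] by simp
    have rest: "\<bar>(\<epsilon> + \<gamma>) * (norm (x - x0, z - z0) - norm (x1 - x0, z2 - z0))\<bar> \<le> (\<epsilon> + \<gamma>) * d"
      unfolding abs_mult using tri dxz \<epsilon> \<gamma> by (simp add: mult_left_mono)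
    have "\<bar>blinfun_apply xs (x - x1)\<bar> \<le> norm xs * d" "\<bar>blinfun_apply zs (z - z2)\<bar> \<le> norm zs * d"
      using norm_blinfun[of xs "x - x1"] norm_blinfun[of zs "z - z2"]
        mult_left_mono[OF dx norm_ge_zero[of xs]] mult_left_mono[OF dz norm_ge_zero[of zs]]
      by auto
    then have "\<bar>D\<bar> \<le> L * d"
      using rest unfolding D a_def L_def by (simp add: distrib_right)
    then have "D\<^sup>2 \<le> (L * d)\<^sup>2" by (rule power2_le_iff_abs_le[THEN iffD2, rotated]) (use L d0 in simp)
    also have "\<dots> \<le> r * \<eta> / 3 * d"
    proof -
      have "d \<le> r * \<eta> / (3 * L\<^sup>2)" using d(2) by (simp add: \<delta>2_def)
      then have "L\<^sup>2 * d \<le> r * \<eta> / 3" using L by (simp add: field_simps)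
      from mult_right_mono[OF this d0] show ?thesis by (simp add: power2_eq_square mult_ac)
    qed
    finally have 4: "D\<^sup>2 \<le> r * \<eta> / 3 * d" .
    \<comment> \<open>only this upper bound for \<open>D\<close> is needed, because \<open>s1\<close> is nonnegative\<close>
    have 5: "s1 * D \<le> s1 * (- a + (\<epsilon> + \<gamma>) * d)"
      using rest \<open>s1 \<ge> 0\<close> unfolding D by (intro mult_left_mono) auto
    have "2 * (s1 * a - (blinfun_apply J (y - y1) - blinfun_apply J (y' - y2)))
        \<le> 2 * r * \<sigma> * d + r * \<eta> / 3 * d + r * \<eta> / 3 * d + 2 * (s1 * ((\<epsilon> + \<gamma>) * d))"
      using 1 2 3 4 5 r2 by (simp add: algebra_simps)
    then have 6: "s1 * a - (blinfun_apply J (y - y1) - blinfun_apply J (y' - y2))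
        \<le> r * (\<sigma> + \<eta> / 3) * d + s1 * ((\<epsilon> + \<gamma>) * d)"
      by (simp add: algebra_simps)
    have "s1 = r * \<beta>" "J = r *\<^sub>R j" using r by (auto simp: \<beta>_def j_def)
    then have "r * (\<beta> * a - (blinfun_apply j (y - y1) - blinfun_apply j (y' - y2)))
        \<le> r * ((\<sigma> + \<eta> / 3) * d + \<beta> * ((\<epsilon> + \<gamma>) * d))"
      using 6 by (simp add: blinfun.scaleR_left algebra_simps)
    then have "\<beta> * a - (blinfun_apply j (y - y1) - blinfun_apply j (y' - y2))
        \<le> (\<sigma> + \<eta> / 3) * d + \<beta> * ((\<epsilon> + \<gamma>) * d)"
      using r by simp
    also have "\<dots> \<le> (\<eta> / 3 + \<eta> / 3) * d + 1 * ((\<epsilon> + \<gamma>) * d)"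
      using \<sigma>(3) \<beta>1 d0 \<epsilon> \<gamma> by (intro add_mono mult_right_mono) auto
    also have "\<dots> = (\<epsilon> + \<eta>) * d" by (simp add: \<gamma>_def algebra_simps)
    finally show ?thesis by (simp add: a_def)
  qed
  have KA1: "(x1, y1) \<in> KA" "(y2, z2) \<in> KB" using v(1) by (auto simp: v_eq)
  define \<delta>3 where "\<delta>3 = min \<delta>2 (\<rho> / 2)"
  have \<delta>3: "\<delta>3 > 0" using \<delta>2 \<rho> by (simp add: \<delta>3_def)
  have inKA: "u \<in> KA" if "u \<in> A" "dist u (x1, y1) < \<delta>3" for u
    using that dist_triangle[of u "(x0, y0)" "(x1, y1)"] d1 \<sigma>(2)
    by (simp add: KA_def \<delta>3_def dist_commute)
  have inKB: "u \<in> KB" if "u \<in> B" "dist u (y2, z2) < \<delta>3" for u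
    using that dist_triangle[of u "(y0, z0)" "(y2, z2)"] d2 \<sigma>(2)
    by (simp add: KB_def \<delta>3_def dist_commute)
  have "dual_pair (\<beta> *\<^sub>R xs) (- j) \<in> eps_normals (\<epsilon> + \<eta>) (x1, y1) A"
  proof (rule eps_normalsI[OF \<delta>3])
    fix u assume u: "u \<in> A" "dist u (x1, y1) < \<delta>3"
    obtain x y where xy: "u = (x, y)" by (metis prod.collapse)
    have "dist ((x, y), (y2, z2)) v = dist (x, y) (x1, y1)"
      by (simp add: v_eq dist_Pair_Pair[of "(x, y)"])
    then have "\<beta> * (blinfun_apply xs (x - x1) - blinfun_apply zs (z2 - z2))
      - blinfun_apply j (y - y1) + blinfun_apply j (y2 - y2) \<le> (\<epsilon> + \<eta>) * dist (x, y) (x1, y1)"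
      using inKA[OF u] u KA1 by (intro key) (auto simp: xy \<delta>3_def)
    then show "blinfun_apply (dual_pair (\<beta> *\<^sub>R xs) (- j)) (u - (x1, y1)) \<le> (\<epsilon> + \<eta>) * norm (u - (x1, y1))"
      by (simp add: xy blinfun.scaleR_left blinfun.minus_left dist_norm)
  qed
  moreover have "dual_pair j (- (\<beta> *\<^sub>R zs)) \<in> eps_normals (\<epsilon> + \<eta>) (y2, z2) B"
  proof (rule eps_normalsI[OF \<delta>3])
    fix u assume u: "u \<in> B" "dist u (y2, z2) < \<delta>3"
    obtain y z where yz: "u = (y, z)" by (metis prod.collapse)
    have "dist ((x1, y1), (y, z)) v = dist (y, z) (y2, z2)"
      by (simp add: v_eq dist_Pair_Pair[of "(x1, y1)"])
    then have "\<beta> * (blinfun_apply xs (x1 - x1) - blinfun_apply zs (z - z2))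
      - blinfun_apply j (y1 - y1) + blinfun_apply j (y - y2) \<le> (\<epsilon> + \<eta>) * dist (y, z) (y2, z2)"
      using inKB[OF u] u KA1 by (intro key) (auto simp: yz \<delta>3_def)
    then show "blinfun_apply (dual_pair j (- (\<beta> *\<^sub>R zs))) (u - (y2, z2)) \<le> (\<epsilon> + \<eta>) * norm (u - (y2, z2))"
      by (simp add: yz blinfun.scaleR_left blinfun.minus_left dist_norm)
  qed
  moreover have "(x1, y1) \<in> A" "(y2, z2) \<in> B" using KA1 by (auto simp: KA_def KB_def)
  moreover have "dist (x1, y1) (x0, y0) < \<eta>" "dist (y2, z2) (y0, z0) < \<eta>"
    using d1 d2 \<sigma>(3) \<eta> by auto
  ultimately show thesis using that \<beta>0 norm1 by blast
qed

text \<open>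
  The functionals \<open>p\<close> and \<open>q\<close> replace \<open>xs\<close> and \<open>zs\<close> in order to meet the tangential constraints at
  the new points.
\<close>

lemma relative_fuzzy_decoupling:
  fixes A :: "('x::banach \<times> 'y::banach) set" and B :: "('y \<times> 'z::banach) set"
  assumes luc: "locally_uniformly_convex TYPE('x \<Rightarrow>\<^sub>L real)"
      "locally_uniformly_convex TYPE('y \<Rightarrow>\<^sub>L real)" "locally_uniformly_convex TYPE('z \<Rightarrow>\<^sub>L real)"
    and cvx: "convex \<Omega>" "convex \<Theta>" "A \<subseteq> \<Omega> \<times> UNIV" "B \<subseteq> UNIV \<times> \<Theta>"
    and A: "(x0, y0) \<in> A" "(x0, y0) \<in> interior CA" "closed CA" "closed (A \<inter> CA)"
    and B: "(y0, z0) \<in> B" "(y0, z0) \<in> interior CB" "closed CB" "closed (B \<inter> CB)"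
    and normal: "dual_pair xs (- zs) \<in> eps_normals \<epsilon> (x0, z0) {(x, z). \<exists>y. (x, y) \<in> A \<and> (y, z) \<in> B}"
    and xs: "xs \<in> duality_image (contingent_cone x0 \<Omega>)"
    and zs: "- zs \<in> duality_image (contingent_cone z0 \<Theta>)"
    and \<epsilon>: "\<epsilon> \<ge> 0" and \<eta>: "\<eta> > 0"
  obtains x1 y1 y2 z2 \<beta> j p q where "(x1, y1) \<in> A" "(y2, z2) \<in> B"
    "dist (x1, y1) (x0, y0) < \<eta>" "dist (y2, z2) (y0, z0) < \<eta>"
    "\<beta> \<ge> 0" "\<beta>\<^sup>2 + (norm j)\<^sup>2 = 1" "norm (p - xs) < \<eta>" "norm (q - zs) < \<eta>"
    "p \<in> duality_image (contingent_cone x1 \<Omega>)" "- q \<in> duality_image (contingent_cone z2 \<Theta>)"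
    "dual_pair (\<beta> *\<^sub>R p) (- j) \<in> eps_normals (\<epsilon> + \<eta>) (x1, y1) A"
    "dual_pair j (- (\<beta> *\<^sub>R q)) \<in> eps_normals (\<epsilon> + \<eta>) (y2, z2) B"
proof -
  obtain \<delta>1 where \<delta>1: "\<delta>1 > 0" "\<And>x. x \<in> \<Omega> \<Longrightarrow> dist x x0 < \<delta>1 \<Longrightarrow>
      \<exists>p\<in>duality_image (contingent_cone x \<Omega>). norm (p - xs) < \<eta> / 2"
    using duality_image_lsc[OF luc(1) cvx(1) xs, of "\<eta> / 2"] \<eta> by (metis half_gt_zero)
  obtain \<delta>2 where \<delta>2: "\<delta>2 > 0" "\<And>z. z \<in> \<Theta> \<Longrightarrow> dist z z0 < \<delta>2 \<Longrightarrow>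
      \<exists>q\<in>duality_image (contingent_cone z \<Theta>). norm (q - (- zs)) < \<eta> / 2"
    using duality_image_lsc[OF luc(3) cvx(2) zs, of "\<eta> / 2"] \<eta> by (metis half_gt_zero)
  define \<eta>' where "\<eta>' = min (\<eta> / 2) (min \<delta>1 \<delta>2)"
  have \<eta>': "\<eta>' > 0" "\<eta>' \<le> \<eta> / 2" "\<eta>' \<le> \<delta>1" "\<eta>' \<le> \<delta>2" using \<eta> \<delta>1 \<delta>2 by (auto simp: \<eta>'_def)
  obtain x1 y1 y2 z2 \<beta> j where *: "(x1, y1) \<in> A" "(y2, z2) \<in> B"
    "dist (x1, y1) (x0, y0) < \<eta>'" "dist (y2, z2) (y0, z0) < \<eta>'"
    "\<beta> \<ge> 0" "\<beta>\<^sup>2 + (norm j)\<^sup>2 = 1"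
    "dual_pair (\<beta> *\<^sub>R xs) (- j) \<in> eps_normals (\<epsilon> + \<eta>') (x1, y1) A"
    "dual_pair j (- (\<beta> *\<^sub>R zs)) \<in> eps_normals (\<epsilon> + \<eta>') (y2, z2) B"
    by (rule fuzzy_decoupling[OF luc(2) A B normal \<epsilon> \<eta>'(1)])
  have \<beta>1: "\<beta> \<le> 1"
    using *(6) by (intro power2_le_imp_le[of \<beta> 1]) (auto, smt (verit) zero_le_power2)
  have "dist x1 x0 < \<delta>1" "x1 \<in> \<Omega>"
    using dist_fst_le[of "(x1, y1)" "(x0, y0)"] *(1,3) \<eta>' cvx(3) by auto
  then obtain p where p: "p \<in> duality_image (contingent_cone x1 \<Omega>)" "norm (p - xs) < \<eta> / 2"
    using \<delta>1 by blast
  have "dist z2 z0 < \<delta>2" "z2 \<in> \<Theta>"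
    using dist_snd_le[of "(y2, z2)" "(y0, z0)"] *(2,4) \<eta>' cvx(4) by auto
  then obtain q' where q': "q' \<in> duality_image (contingent_cone z2 \<Theta>)" "norm (q' - (- zs)) < \<eta> / 2"
    using \<delta>2 by blast
  define q where "q = - q'"
  have q: "- q \<in> duality_image (contingent_cone z2 \<Theta>)" "norm (q - zs) < \<eta> / 2"
    using q' norm_minus_commute[of q zs] by (auto simp: q_def add.commute)
  have "norm (dual_pair (\<beta> *\<^sub>R p) (- j) - dual_pair (\<beta> *\<^sub>R xs) (- j)) \<le> \<eta> / 2"
  proof -
    have "norm (dual_pair (\<beta> *\<^sub>R p) (- j) - dual_pair (\<beta> *\<^sub>R xs) (- j)) \<le> \<beta> * norm (p - xs)"
      using norm_dual_pair_le[of "\<beta> *\<^sub>R (p - xs)" 0] *(5)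
      unfolding dual_pair_diff by (simp flip: scaleR_diff_right)
    also have "\<dots> \<le> 1 * norm (p - xs)" using \<beta>1 by (intro mult_right_mono) auto
    finally show ?thesis using p(2) by simp
  qed
  then have "dual_pair (\<beta> *\<^sub>R p) (- j) \<in> eps_normals (\<epsilon> + \<eta>) (x1, y1) A"
    by (rule eps_normals_perturb[OF *(7)]) (use \<eta>' in simp)
  moreover have "norm (dual_pair j (- (\<beta> *\<^sub>R q)) - dual_pair j (- (\<beta> *\<^sub>R zs))) \<le> \<eta> / 2"
  proof -
    have eq: "- (\<beta> *\<^sub>R q) - (- (\<beta> *\<^sub>R zs)) = - (\<beta> *\<^sub>R (q - zs))" by (simp add: scaleR_diff_right)
    have "norm (dual_pair j (- (\<beta> *\<^sub>R q)) - dual_pair j (- (\<beta> *\<^sub>R zs))) \<le> \<beta> * norm (q - zs)"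
      using norm_dual_pair_le[of 0 "- (\<beta> *\<^sub>R (q - zs))"] *(5)
      unfolding dual_pair_diff eq by simp
    also have "\<dots> \<le> 1 * norm (q - zs)" using \<beta>1 by (intro mult_right_mono) auto
    finally show ?thesis using q(2) by simp
  qed
  then have "dual_pair j (- (\<beta> *\<^sub>R q)) \<in> eps_normals (\<epsilon> + \<eta>) (y2, z2) B"
    by (rule eps_normals_perturb[OF *(8)]) (use \<eta>' in simp)
  ultimately show thesis
    using *(1-6) p q \<eta>' \<eta> by (intro that[of x1 y1 y2 z2 \<beta> j p q]) auto
qed

section \<open>Weak* convergence and coderivative sequences\<close>

lemma weak_star_subseq:
  "weak_star_tendsto f g \<Longrightarrow> strict_mono s \<Longrightarrow> weak_star_tendsto (\<lambda>k. f (s k)) g"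
  unfolding weak_star_tendsto_def by (auto intro: LIMSEQ_subseq_LIMSEQ[unfolded o_def])

lemma weak_star_scale:
  assumes "weak_star_tendsto f g" and "c \<longlonglongrightarrow> a"
  shows "weak_star_tendsto (\<lambda>k. c k *\<^sub>R f k) (a *\<^sub>R g)"
  using assms unfolding weak_star_tendsto_def
  by (auto simp: blinfun.scaleR_left intro: tendsto_mult)

lemma weak_star_perturb:
  assumes f: "weak_star_tendsto f g" and h: "(\<lambda>k. h k - f k) \<longlonglongrightarrow> 0"
  shows "weak_star_tendsto h g"
  unfolding weak_star_tendsto_def
proof
  fix x
  have "(\<lambda>k. blinfun_apply (h k - f k) x) \<longlonglongrightarrow> blinfun_apply 0 x"
    using h by (intro tendsto_intros)
  then have "(\<lambda>k. blinfun_apply (h k - f k) x + blinfun_apply (f k) x) \<longlonglongrightarrow> 0 + blinfun_apply g x"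
    using f by (intro tendsto_add) (auto simp: weak_star_tendsto_def)
  then show "(\<lambda>k. blinfun_apply (h k) x) \<longlonglongrightarrow> blinfun_apply g x" by (simp add: blinfun.diff_left)
qed

lemma scaled_tendsto_zero:
  fixes f :: "nat \<Rightarrow> 'a::banach \<Rightarrow>\<^sub>L real"
  assumes "weak_star_tendsto f g" and "c \<longlonglongrightarrow> 0"
  shows "(\<lambda>k. c k *\<^sub>R f k) \<longlonglongrightarrow> 0"
proof -
  obtain B where B: "\<And>n. norm (f n) \<le> B" "B \<ge> 0"
    using weak_star_convergent_bounded[OF assms(1)] by blast
  have lim: "(\<lambda>k. \<bar>c k\<bar> * B) \<longlonglongrightarrow> 0"
    using assms(2) by (auto intro: tendsto_mult_left_zero tendsto_rabs_zero)
  have "\<forall>\<^sub>F k in sequentially. norm (c k *\<^sub>R f k) \<le> \<bar>c k\<bar> * B"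
    using B by (simp add: mult_left_mono)
  then show ?thesis using lim by (rule Lim_null_comparison)
qed

lemma coderiv_seq_subseq:
  assumes "coderiv_seq S \<Omega> \<Theta> x y \<epsilon> xk yk xsk ysk" and "strict_mono s"
  shows "coderiv_seq S \<Omega> \<Theta> x y (\<lambda>k. \<epsilon> (s k)) (\<lambda>k. xk (s k)) (\<lambda>k. yk (s k))
    (\<lambda>k. xsk (s k)) (\<lambda>k. ysk (s k))"
  using assms(1) unfolding coderiv_seq_def down_to_zero_def
  by (auto intro: LIMSEQ_subseq_LIMSEQ[OF _ assms(2), unfolded o_def])

text \<open>
  The bound \<open>\<epsilon>\<^sub>k < 1\<close> required in the PSNC conditions holds for a tail of any sequence.
\<close>

lemma coderiv_seq_small_tail:
  assumes "coderiv_seq S \<Omega> \<Theta> x y \<epsilon> xk yk xsk ysk"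
  obtains m where "\<And>k. \<epsilon> (k + m) \<in> {0<..<1}"
    "coderiv_seq S \<Omega> \<Theta> x y (\<lambda>k. \<epsilon> (k + m)) (\<lambda>k. xk (k + m)) (\<lambda>k. yk (k + m))
      (\<lambda>k. xsk (k + m)) (\<lambda>k. ysk (k + m))"
proof -
  have \<epsilon>: "\<epsilon> \<longlonglongrightarrow> 0" "\<And>k. \<epsilon> k > 0" using assms by (auto simp: coderiv_seq_def down_to_zero_def)
  have "\<forall>\<^sub>F k in sequentially. \<epsilon> k < 1" using \<epsilon>(1) by (rule order_tendstoD) simp
  then obtain m where "\<And>k. k \<ge> m \<Longrightarrow> \<epsilon> k < 1" by (auto simp: eventually_sequentially)
  with \<epsilon>(2) show thesis
    by (intro that[of m] coderiv_seq_subseq[OF assms]) (auto simp: strict_mono_def)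
qed

lemma PSNC_D:
  assumes "PSNC S \<Omega> \<Theta> x y" "coderiv_seq S \<Omega> \<Theta> x y \<epsilon> xk yk xsk ysk"
    "weak_star_tendsto xsk 0" "ysk \<longlonglongrightarrow> 0"
  shows "xsk \<longlonglongrightarrow> 0"
proof -
  obtain m where m: "\<And>k. \<epsilon> (k + m) \<in> {0<..<1}"
    "coderiv_seq S \<Omega> \<Theta> x y (\<lambda>k. \<epsilon> (k + m)) (\<lambda>k. xk (k + m)) (\<lambda>k. yk (k + m))
      (\<lambda>k. xsk (k + m)) (\<lambda>k. ysk (k + m))"
    using coderiv_seq_small_tail[OF assms(2)] by blast
  have "weak_star_tendsto (\<lambda>k. xsk (k + m)) 0" "(\<lambda>k. ysk (k + m)) \<longlonglongrightarrow> 0"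
    using weak_star_subseq[OF assms(3), of "\<lambda>k. k + m"] LIMSEQ_ignore_initial_segment[OF assms(4)]
    by (auto simp: strict_mono_def)
  then have "(\<lambda>k. norm (xsk (k + m))) \<longlonglongrightarrow> 0"
    using assms(1)[unfolded PSNC_def, rule_format, OF conjI[OF allI conjI[OF _ conjI]], OF m(1) m(2)] by blast
  then show ?thesis using LIMSEQ_offset tendsto_norm_zero_iff by blast
qed

lemma mirror_PSNC_D:
  assumes "mirror_PSNC S \<Omega> \<Theta> x y" "coderiv_seq S \<Omega> \<Theta> x y \<epsilon> xk yk xsk ysk"
    "xsk \<longlonglongrightarrow> 0" "weak_star_tendsto ysk 0"
  shows "ysk \<longlonglongrightarrow> 0"
proof -
  obtain m where m: "\<And>k. \<epsilon> (k + m) \<in> {0<..<1}"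
    "coderiv_seq S \<Omega> \<Theta> x y (\<lambda>k. \<epsilon> (k + m)) (\<lambda>k. xk (k + m)) (\<lambda>k. yk (k + m))
      (\<lambda>k. xsk (k + m)) (\<lambda>k. ysk (k + m))"
    using coderiv_seq_small_tail[OF assms(2)] by blast
  have "weak_star_tendsto (\<lambda>k. ysk (k + m)) 0" "(\<lambda>k. xsk (k + m)) \<longlonglongrightarrow> 0"
    using weak_star_subseq[OF assms(4), of "\<lambda>k. k + m"] LIMSEQ_ignore_initial_segment[OF assms(3)]
    by (auto simp: strict_mono_def)
  then have "(\<lambda>k. norm (ysk (k + m))) \<longlonglongrightarrow> 0"
    using assms(1)[unfolded mirror_PSNC_def, rule_format, OF conjI[OF allI conjI[OF _ conjI]], OF m(1) m(2)] by blast
  then show ?thesis using LIMSEQ_offset tendsto_norm_zero_iff by blast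
qed

section \<open>The coderivative inclusions for compositions\<close>

lemma gph_mcomp:
  "gph (mrestrict (mcomp S2 S1) \<Omega> \<Theta>) =
    {(x, z). \<exists>y. (x, y) \<in> gph (mrestrict S1 \<Omega> UNIV) \<and> (y, z) \<in> gph (mrestrict S2 UNIV \<Theta>)}"
  by (auto simp: gph_def mrestrict_def mcomp_def split: if_splits)

lemma intermediate_sequence:
  assumes G_eq: "\<And>x z. G (x, z) = {y \<in> S1 x. z \<in> S2 y}"
    and isc: "inner_semicontinuous G (\<Omega> \<times> \<Theta>) (x, z) y"
    and gph: "\<And>k. (xk k, zk k) \<in> gph (mrestrict (mcomp S2 S1) \<Omega> \<Theta>)"
    and lim: "xk \<longlonglongrightarrow> x" "zk \<longlonglongrightarrow> z"
  obtains yk where "yk \<longlonglongrightarrow> y" "\<And>k. (xk k, yk k) \<in> gph (mrestrict S1 \<Omega> UNIV)"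
    "\<And>k. (yk k, zk k) \<in> gph (mrestrict S2 UNIV \<Theta>)"
proof -
  have in_dom: "(xk k, zk k) \<in> mdom G \<inter> \<Omega> \<times> \<Theta>" for k
    using gph[of k] by (auto simp: mcomp_def gph_def mrestrict_def mdom_def G_eq split: if_splits)
  have "(\<lambda>k. (xk k, zk k)) \<longlonglongrightarrow> (x, z)" using lim by (rule tendsto_Pair)
  then obtain yk where yk: "\<And>k. yk k \<in> G (xk k, zk k)" "yk \<longlonglongrightarrow> y"
    using isc[unfolded inner_semicontinuous_def, THEN conjunct2, rule_format, of "\<lambda>k. (xk k, zk k)"] in_dom
    by blast
  have "(xk k, yk k) \<in> gph (mrestrict S1 \<Omega> UNIV)" "(yk k, zk k) \<in> gph (mrestrict S2 UNIV \<Theta>)" for k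
    using yk(1)[of k] in_dom[of k] by (auto simp: G_eq gph_def mrestrict_def)
  with yk(2) show thesis by (rule that)
qed

text \<open>
  The decoupling step is applied at every index beyond the first few, which brings the reference
  points into the regions where the graphs are closed; then a subsequence is taken along which \<open>\<beta>\<close>
  and \<open>j\<close> converge.
\<close>

lemma decoupled_sequences:
  fixes S1 :: "'x::banach \<Rightarrow> 'y::banach set" and S2 :: "'y \<Rightarrow> 'z::banach set"
  assumes X: "lur_reflexive TYPE('x)" and Y: "lur_reflexive TYPE('y)" and Z: "lur_reflexive TYPE('z)"
    and cvx: "convex \<Omega>" "convex \<Theta>"
    and G_eq: "\<And>x z. G (x, z) = {y \<in> S1 x. z \<in> S2 y}"
    and A: "closed_around (gph (mrestrict S1 \<Omega> UNIV)) (x, y)"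
    and B: "closed_around (gph (mrestrict S2 UNIV \<Theta>)) (y, z)"
    and isc: "inner_semicontinuous G (\<Omega> \<times> \<Theta>) (x, z) y"
    and seq: "coderiv_seq (mcomp S2 S1) \<Omega> \<Theta> x z \<epsilon> xk zk xsk zsk"
    and weak: "weak_star_tendsto xsk xs" "weak_star_tendsto zsk zs"
  obtains \<epsilon>' x1 y1 y2 z2 \<beta> j a l p q where "down_to_zero \<epsilon>'"
    "x1 \<longlonglongrightarrow> x" "y1 \<longlonglongrightarrow> y" "y2 \<longlonglongrightarrow> y" "z2 \<longlonglongrightarrow> z"
    "\<And>k. (x1 k, y1 k) \<in> gph (mrestrict S1 \<Omega> UNIV)" "\<And>k. (y2 k, z2 k) \<in> gph (mrestrict S2 UNIV \<Theta>)"
    "\<And>k::nat. \<beta> k \<ge> 0" "\<And>k. (\<beta> k)\<^sup>2 + (norm (j k))\<^sup>2 = 1"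
    "\<beta> \<longlonglongrightarrow> a" "weak_star_tendsto j l" "weak_star_tendsto p xs" "weak_star_tendsto q zs"
    "zsk \<longlonglongrightarrow> zs \<longrightarrow> q \<longlonglongrightarrow> zs"
    "\<And>k. p k \<in> duality_image (contingent_cone (x1 k) \<Omega>)"
    "\<And>k. - q k \<in> duality_image (contingent_cone (z2 k) \<Theta>)"
    "\<And>k. dual_pair (\<beta> k *\<^sub>R p k) (- j k) \<in> eps_normals (\<epsilon>' k) (x1 k, y1 k) (gph (mrestrict S1 \<Omega> UNIV))"
    "\<And>k. dual_pair (j k) (- (\<beta> k *\<^sub>R q k)) \<in> eps_normals (\<epsilon>' k) (y2 k, z2 k) (gph (mrestrict S2 UNIV \<Theta>))"
proof -
  let ?A = "gph (mrestrict S1 \<Omega> UNIV)" and ?B = "gph (mrestrict S2 UNIV \<Theta>)"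
  obtain CA where CA: "closed CA" "(x, y) \<in> interior CA" "closed (?A \<inter> CA)"
    using A by (auto simp: closed_around_def)
  obtain CB where CB: "closed CB" "(y, z) \<in> interior CB" "closed (?B \<inter> CB)"
    using B by (auto simp: closed_around_def)
  have \<epsilon>: "\<And>k. \<epsilon> k > 0" "\<epsilon> \<longlonglongrightarrow> 0" and xk: "xk \<longlonglongrightarrow> x" and zk: "zk \<longlonglongrightarrow> z"
    and gphk: "\<And>k. (xk k, zk k) \<in> gph (mrestrict (mcomp S2 S1) \<Omega> \<Theta>)"
    and normal: "\<And>k. dual_pair (xsk k) (- zsk k)
        \<in> eps_normals (\<epsilon> k) (xk k, zk k) {(x, z). \<exists>y. (x, y) \<in> ?A \<and> (y, z) \<in> ?B}"
    and xsk: "\<And>k. xsk k \<in> duality_image (contingent_cone (xk k) \<Omega>)"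
    and zsk: "\<And>k. - zsk k \<in> duality_image (contingent_cone (zk k) \<Theta>)"
    using seq by (auto simp: coderiv_seq_def down_to_zero_def gph_mcomp)
  obtain yk where yk: "yk \<longlonglongrightarrow> y" "\<And>k. (xk k, yk k) \<in> ?A" "\<And>k. (yk k, zk k) \<in> ?B"
    using intermediate_sequence[OF G_eq isc gphk xk zk] by blast
  have "\<forall>\<^sub>F k in sequentially. (xk k, yk k) \<in> interior CA"
    by (rule topological_tendstoD[OF tendsto_Pair[OF xk yk(1)] open_interior CA(2)])
  moreover have "\<forall>\<^sub>F k in sequentially. (yk k, zk k) \<in> interior CB"
    by (rule topological_tendstoD[OF tendsto_Pair[OF yk(1) zk] open_interior CB(2)])
  ultimately have "\<forall>\<^sub>F k in sequentially. (xk k, yk k) \<in> interior CA \<and> (yk k, zk k) \<in> interior CB"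
    by (rule eventually_conj)
  then obtain N where N: "\<And>k. k \<ge> N \<Longrightarrow> (xk k, yk k) \<in> interior CA"
    "\<And>k. k \<ge> N \<Longrightarrow> (yk k, zk k) \<in> interior CB"
    by (auto simp: eventually_sequentially)
  define \<eta> where "\<eta> k = inverse (real (Suc k))" for k
  have \<eta>: "\<And>k. \<eta> k > 0" "\<eta> \<longlonglongrightarrow> 0" unfolding \<eta>_def using LIMSEQ_inverse_real_of_nat by auto
  have luc: "locally_uniformly_convex TYPE('x \<Rightarrow>\<^sub>L real)"
      "locally_uniformly_convex TYPE('y \<Rightarrow>\<^sub>L real)" "locally_uniformly_convex TYPE('z \<Rightarrow>\<^sub>L real)"
    using X Y Z by (auto simp: lur_reflexive_def)
  have sub: "?A \<subseteq> \<Omega> \<times> UNIV" "?B \<subseteq> UNIV \<times> \<Theta>"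
    by (auto simp: gph_def mrestrict_def split: if_splits)
  have "\<forall>k. \<exists>x1 y1 y2 z2 \<beta> j p q. (x1, y1) \<in> ?A \<and> (y2, z2) \<in> ?B \<and>
      dist (x1, y1) (xk (k + N), yk (k + N)) < \<eta> k \<and> dist (y2, z2) (yk (k + N), zk (k + N)) < \<eta> k \<and>
      \<beta> \<ge> 0 \<and> \<beta>\<^sup>2 + (norm j)\<^sup>2 = 1 \<and> norm (p - xsk (k + N)) < \<eta> k \<and> norm (q - zsk (k + N)) < \<eta> k \<and>
      p \<in> duality_image (contingent_cone x1 \<Omega>) \<and> - q \<in> duality_image (contingent_cone z2 \<Theta>) \<and>
      dual_pair (\<beta> *\<^sub>R p) (- j) \<in> eps_normals (\<epsilon> (k + N) + \<eta> k) (x1, y1) ?A \<and>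
      dual_pair j (- (\<beta> *\<^sub>R q)) \<in> eps_normals (\<epsilon> (k + N) + \<eta> k) (y2, z2) ?B"
  proof
    fix k
    have k: "(xk (k + N), yk (k + N)) \<in> interior CA" "(yk (k + N), zk (k + N)) \<in> interior CB"
      by (auto intro: N)
    obtain x1 y1 y2 z2 \<beta> j p q where *: "(x1, y1) \<in> ?A" "(y2, z2) \<in> ?B"
      "dist (x1, y1) (xk (k + N), yk (k + N)) < \<eta> k" "dist (y2, z2) (yk (k + N), zk (k + N)) < \<eta> k"
      "\<beta> \<ge> 0" "\<beta>\<^sup>2 + (norm j)\<^sup>2 = 1" "norm (p - xsk (k + N)) < \<eta> k" "norm (q - zsk (k + N)) < \<eta> k"
      "p \<in> duality_image (contingent_cone x1 \<Omega>)" "- q \<in> duality_image (contingent_cone z2 \<Theta>)"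
      "dual_pair (\<beta> *\<^sub>R p) (- j) \<in> eps_normals (\<epsilon> (k + N) + \<eta> k) (x1, y1) ?A"
      "dual_pair j (- (\<beta> *\<^sub>R q)) \<in> eps_normals (\<epsilon> (k + N) + \<eta> k) (y2, z2) ?B"
      by (rule relative_fuzzy_decoupling[OF luc cvx sub yk(2) k(1) CA(1,3) yk(3) k(2) CB(1,3)
            normal xsk zsk less_imp_le[OF \<epsilon>(1)] \<eta>(1)[of k]])
    show "\<exists>x1 y1 y2 z2 \<beta> j p q. (x1, y1) \<in> ?A \<and> (y2, z2) \<in> ?B \<and>
      dist (x1, y1) (xk (k + N), yk (k + N)) < \<eta> k \<and> dist (y2, z2) (yk (k + N), zk (k + N)) < \<eta> k \<and>
      \<beta> \<ge> 0 \<and> \<beta>\<^sup>2 + (norm j)\<^sup>2 = 1 \<and> norm (p - xsk (k + N)) < \<eta> k \<and> norm (q - zsk (k + N)) < \<eta> k \<and>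
      p \<in> duality_image (contingent_cone x1 \<Omega>) \<and> - q \<in> duality_image (contingent_cone z2 \<Theta>) \<and>
      dual_pair (\<beta> *\<^sub>R p) (- j) \<in> eps_normals (\<epsilon> (k + N) + \<eta> k) (x1, y1) ?A \<and>
      dual_pair j (- (\<beta> *\<^sub>R q)) \<in> eps_normals (\<epsilon> (k + N) + \<eta> k) (y2, z2) ?B"
      by (intro exI conjI) (rule *)+
  qed
  then obtain x1 y1 y2 z2 \<beta> j p q where seqs: "\<And>k. (x1 k, y1 k) \<in> ?A" "\<And>k. (y2 k, z2 k) \<in> ?B"
      "\<And>k. dist (x1 k, y1 k) (xk (k + N), yk (k + N)) < \<eta> k"
      "\<And>k. dist (y2 k, z2 k) (yk (k + N), zk (k + N)) < \<eta> k"
      "\<And>k. \<beta> k \<ge> 0" "\<And>k. (\<beta> k)\<^sup>2 + (norm (j k))\<^sup>2 = 1"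
      "\<And>k. norm (p k - xsk (k + N)) < \<eta> k" "\<And>k. norm (q k - zsk (k + N)) < \<eta> k"
      "\<And>k. p k \<in> duality_image (contingent_cone (x1 k) \<Omega>)"
      "\<And>k. - q k \<in> duality_image (contingent_cone (z2 k) \<Theta>)"
      "\<And>k. dual_pair (\<beta> k *\<^sub>R p k) (- j k) \<in> eps_normals (\<epsilon> (k + N) + \<eta> k) (x1 k, y1 k) ?A"
      "\<And>k. dual_pair (j k) (- (\<beta> k *\<^sub>R q k)) \<in> eps_normals (\<epsilon> (k + N) + \<eta> k) (y2 k, z2 k) ?B"
    unfolding choice_iff by (elim exE) blast
  have near: "f \<longlonglongrightarrow> c" if "g \<longlonglongrightarrow> c" and fg: "\<And>k. dist (f k) (g (k + N)) \<le> \<eta> k"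
    for f g :: "nat \<Rightarrow> 'b::real_normed_vector" and c
  proof -
    have "(\<lambda>k. g (k + N)) \<longlonglongrightarrow> c" using that(1) by (rule LIMSEQ_ignore_initial_segment)
    moreover have "(\<lambda>k. f k - g (k + N)) \<longlonglongrightarrow> 0"
      by (rule Lim_null_comparison[OF _ \<eta>(2)]) (use fg in \<open>simp add: dist_norm\<close>)
    ultimately have "(\<lambda>k. g (k + N) + (f k - g (k + N))) \<longlonglongrightarrow> c + 0" by (rule tendsto_add)
    then show ?thesis by simp
  qed
  have dists: "dist (x1 k) (xk (k + N)) \<le> \<eta> k" "dist (y1 k) (yk (k + N)) \<le> \<eta> k"
    "dist (y2 k) (yk (k + N)) \<le> \<eta> k" "dist (z2 k) (zk (k + N)) \<le> \<eta> k" for k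
    using seqs(3,4)[of k] dist_fst_le[of "(x1 k, y1 k)" "(xk (k + N), yk (k + N))"]
      dist_snd_le[of "(x1 k, y1 k)" "(xk (k + N), yk (k + N))"]
      dist_fst_le[of "(y2 k, z2 k)" "(yk (k + N), zk (k + N))"]
      dist_snd_le[of "(y2 k, z2 k)" "(yk (k + N), zk (k + N))"] by auto
  have lims: "x1 \<longlonglongrightarrow> x" "y1 \<longlonglongrightarrow> y" "y2 \<longlonglongrightarrow> y" "z2 \<longlonglongrightarrow> z"
    using near[OF xk dists(1)] near[OF yk(1) dists(2)] near[OF yk(1) dists(3)] near[OF zk dists(4)]
    by auto
  have shift: "strict_mono (\<lambda>k. k + N)" by (simp add: strict_mono_def)
  have pw: "weak_star_tendsto p xs"
    by (rule weak_star_perturb[OF weak_star_subseq[OF weak(1) shift]], rule Lim_null_comparison[OF _ \<eta>(2)])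
      (use seqs(7) in \<open>simp add: less_imp_le\<close>)
  have qw: "weak_star_tendsto q zs"
    by (rule weak_star_perturb[OF weak_star_subseq[OF weak(2) shift]], rule Lim_null_comparison[OF _ \<eta>(2)])
      (use seqs(8) in \<open>simp add: less_imp_le\<close>)
  have qn: "q \<longlonglongrightarrow> zs" if "zsk \<longlonglongrightarrow> zs"
    using seqs(8) by (intro near[OF that]) (auto simp: dist_norm intro: less_imp_le)
  have \<epsilon>': "down_to_zero (\<lambda>k. \<epsilon> (k + N) + \<eta> k)"
    unfolding down_to_zero_def
    using \<epsilon> \<eta> tendsto_add[OF LIMSEQ_ignore_initial_segment[OF \<epsilon>(2), of N] \<eta>(2)]
    by (auto intro: add_pos_pos)
  have sq: "(\<beta> k)\<^sup>2 \<le> 1" "(norm (j k))\<^sup>2 \<le> 1" for k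
    using seqs(6)[of k] zero_le_power2[of "\<beta> k"] zero_le_power2[of "norm (j k)"] by linarith+
  then have "norm (j k) \<le> 1" for k by (intro power2_le_imp_le[of "norm (j k)" 1]) auto
  then obtain r l where r: "strict_mono r" "weak_star_tendsto (\<lambda>k. j (r k)) l"
    using weak_star_convergent_subsequence[of j 1] Y unfolding lur_reflexive_def by blast
  have "\<beta> k \<le> 1" for k using sq by (intro power2_le_imp_le[of "\<beta> k" 1]) auto
  then have "bounded (range (\<lambda>k. \<beta> (r k)))"
    using seqs(5) by (auto simp: bounded_iff intro!: exI[of _ 1])
  then obtain a r' where r': "strict_mono r'" "((\<lambda>k. \<beta> (r k)) \<circ> r') \<longlonglongrightarrow> a"
    using bounded_imp_convergent_subsequence by blast
  define s where "s = r \<circ> r'"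
  have s: "strict_mono s" unfolding s_def by (intro strict_mono_o r r')
  have sub_lim: "(\<lambda>k. f (s k)) \<longlonglongrightarrow> c" if "f \<longlonglongrightarrow> c" for f :: "nat \<Rightarrow> 'b::topological_space" and c
    using LIMSEQ_subseq_LIMSEQ[OF that s] by (simp add: o_def)
  show thesis
  proof (rule that[of "\<lambda>k. \<epsilon> (s k + N) + \<eta> (s k)" "\<lambda>k. x1 (s k)" "\<lambda>k. y1 (s k)" "\<lambda>k. y2 (s k)"
        "\<lambda>k. z2 (s k)" "\<lambda>k. \<beta> (s k)" "\<lambda>k. j (s k)" a l "\<lambda>k. p (s k)" "\<lambda>k. q (s k)"])
    show "down_to_zero (\<lambda>k. \<epsilon> (s k + N) + \<eta> (s k))"
      using \<epsilon>' sub_lim[of "\<lambda>k. \<epsilon> (k + N) + \<eta> k" 0] by (simp add: down_to_zero_def)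
    show "(\<lambda>k. \<beta> (s k)) \<longlonglongrightarrow> a" using r'(2) by (simp add: o_def s_def)
    show "weak_star_tendsto (\<lambda>k. j (s k)) l"
      using weak_star_subseq[OF r(2) r'(1)] by (simp add: s_def)
    show "weak_star_tendsto (\<lambda>k. p (s k)) xs" "weak_star_tendsto (\<lambda>k. q (s k)) zs"
      using pw qw s by (auto intro: weak_star_subseq)
  qed (use seqs lims qn sub_lim in auto)
qed

lemma composition_rule:
  fixes S1 :: "'x::banach \<Rightarrow> 'y::banach set" and S2 :: "'y \<Rightarrow> 'z::banach set"
  assumes X: "lur_reflexive TYPE('x)" and Y: "lur_reflexive TYPE('y)" and Z: "lur_reflexive TYPE('z)"
    and cvx: "convex \<Omega>" "convex \<Theta>"
    and G_eq: "\<And>x z. G (x, z) = {y \<in> S1 x. z \<in> S2 y}"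
    and A: "closed_around (gph (mrestrict S1 \<Omega> UNIV)) (x, y)"
    and B: "closed_around (gph (mrestrict S2 UNIV \<Theta>)) (y, z)"
    and isc: "inner_semicontinuous G (\<Omega> \<times> \<Theta>) (x, z) y"
    and psnc: "mirror_PSNC S1 \<Omega> UNIV x y \<or> PSNC S2 UNIV \<Theta> y z"
    and qc: "mker (mirror_coderiv S1 \<Omega> UNIV x y) \<inter> mixed_coderiv S2 UNIV \<Theta> y z 0 = {0}"
    and seq: "coderiv_seq (mcomp S2 S1) \<Omega> \<Theta> x z \<epsilon> xk zk xsk zsk"
    and weak: "weak_star_tendsto xsk xs" "weak_star_tendsto zsk zs"
  obtains ys where "xs \<in> normal_coderiv S1 \<Omega> UNIV x y ys" "ys \<in> normal_coderiv S2 UNIV \<Theta> y z zs"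
    "zsk \<longlonglongrightarrow> zs \<Longrightarrow> ys \<in> mixed_coderiv S2 UNIV \<Theta> y z zs"
proof (rule decoupled_sequences[OF X Y Z cvx G_eq A B isc seq weak])
  let ?A = "gph (mrestrict S1 \<Omega> UNIV)" and ?B = "gph (mrestrict S2 UNIV \<Theta>)"
  fix \<epsilon>' x1 y1 y2 z2 \<beta> j a l p q
  assume \<epsilon>': "down_to_zero \<epsilon>'"
    and lims: "x1 \<longlonglongrightarrow> x" "y1 \<longlonglongrightarrow> y" "y2 \<longlonglongrightarrow> y" "z2 \<longlonglongrightarrow> z"
    and inA: "\<And>k. (x1 k, y1 k) \<in> ?A" and inB: "\<And>k. (y2 k, z2 k) \<in> ?B"
    and \<beta>: "\<And>k::nat. \<beta> k \<ge> 0" "\<And>k. (\<beta> k)\<^sup>2 + (norm (j k))\<^sup>2 = 1" "\<beta> \<longlonglongrightarrow> a"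
    and j: "weak_star_tendsto j l" and p: "weak_star_tendsto p xs" and q: "weak_star_tendsto q zs"
    and qn: "zsk \<longlonglongrightarrow> zs \<longrightarrow> q \<longlonglongrightarrow> zs"
    and pJ: "\<And>k. p k \<in> duality_image (contingent_cone (x1 k) \<Omega>)"
    and qJ: "\<And>k. - q k \<in> duality_image (contingent_cone (z2 k) \<Theta>)"
    and nA: "\<And>k. dual_pair (\<beta> k *\<^sub>R p k) (- j k) \<in> eps_normals (\<epsilon>' k) (x1 k, y1 k) ?A"
    and nB: "\<And>k. dual_pair (j k) (- (\<beta> k *\<^sub>R q k)) \<in> eps_normals (\<epsilon>' k) (y2 k, z2 k) ?B"
  have in\<Omega>: "x1 k \<in> \<Omega>" "z2 k \<in> \<Theta>" for k
    using inA[of k] inB[of k] by (auto simp: gph_def mrestrict_def split: if_splits)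
  have Yall: "f \<in> duality_image (contingent_cone v UNIV)" for f and v :: 'y
    using duality_image_UNIV[of v] Y by (simp add: lur_reflexive_def)
  have "a \<ge> 0" using \<beta>(1,3) by (intro LIMSEQ_le_const) auto
  \<comment> \<open>\<open>a = 0\<close> would make \<open>l\<close> violate the qualification condition or \<open>j\<close> violate a PSNC condition\<close>
  have "a > 0"
  proof (rule ccontr)
    assume "\<not> a > 0"
    then have a0: "\<beta> \<longlonglongrightarrow> 0" using \<open>a \<ge> 0\<close> \<beta>(3) by simp
    have p0: "(\<lambda>k. \<beta> k *\<^sub>R p k) \<longlonglongrightarrow> 0" and q0: "(\<lambda>k. \<beta> k *\<^sub>R q k) \<longlonglongrightarrow> 0"
      using scaled_tendsto_zero p q a0 by auto
    have seq1: "coderiv_seq S1 \<Omega> UNIV x y \<epsilon>' x1 y1 (\<lambda>k. \<beta> k *\<^sub>R p k) j"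
      unfolding coderiv_seq_def
      using \<epsilon>' lims inA nA Yall duality_image_scale[OF pJ in\<Omega>(1) \<beta>(1)] by blast
    have "- (\<beta> k *\<^sub>R q k) \<in> duality_image (contingent_cone (z2 k) \<Theta>)" for k
      using duality_image_scale[OF qJ in\<Omega>(2) \<beta>(1), of k k] by simp
    then have seq2: "coderiv_seq S2 UNIV \<Theta> y z \<epsilon>' y2 z2 j (\<lambda>k. \<beta> k *\<^sub>R q k)"
      unfolding coderiv_seq_def using \<epsilon>' lims inB nB Yall by blast
    have "l \<in> mker (mirror_coderiv S1 \<Omega> UNIV x y)"
      unfolding mker_def mirror_coderiv_def using seq1 p0 j by blast
    moreover have "l \<in> mixed_coderiv S2 UNIV \<Theta> y z 0"
      unfolding mixed_coderiv_def using seq2 q0 j by blast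
    ultimately have "l = 0" using qc by blast
    then have "j \<longlonglongrightarrow> 0"
      using psnc mirror_PSNC_D[OF _ seq1 p0] PSNC_D[OF _ seq2 _ q0] j by blast
    then have "(\<lambda>k. (\<beta> k)\<^sup>2 + (norm (j k))\<^sup>2) \<longlonglongrightarrow> 0\<^sup>2 + (norm (0 :: 'y \<Rightarrow>\<^sub>L real))\<^sup>2"
      by (intro tendsto_intros a0)
    then show False using \<beta>(2) by (simp add: LIMSEQ_const_iff)
  qed
  have "\<forall>\<^sub>F k in sequentially. \<beta> k > 0" using \<beta>(3) \<open>a > 0\<close> by (rule order_tendstoD)
  then obtain m where m: "\<And>k. k \<ge> m \<Longrightarrow> \<beta> k > 0" by (auto simp: eventually_sequentially)
  have pos: "\<beta> (k + m) > 0" for k by (rule m) simp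
  have shift: "strict_mono (\<lambda>k. k + m)" by (simp add: strict_mono_def)
  note lims' = lims[THEN LIMSEQ_ignore_initial_segment[where k = m]]
  define c where "c k = 1 / \<beta> (k + m)" for k
  have c: "c k > 0" "c k * \<beta> (k + m) = 1" for k using pos[of k] by (auto simp: c_def)
  have c_lim: "c \<longlonglongrightarrow> 1 / a"
    unfolding c_def using \<open>a > 0\<close> \<beta>(3) by (intro tendsto_intros LIMSEQ_ignore_initial_segment) auto
  define js where "js k = c k *\<^sub>R j (k + m)" for k
  have js: "weak_star_tendsto js ((1 / a) *\<^sub>R l)"
    unfolding js_def by (rule weak_star_scale[OF weak_star_subseq[OF j shift] c_lim])
  have \<epsilon>'': "down_to_zero (\<lambda>k. c k * \<epsilon>' (k + m))"
    using \<epsilon>' c(1) tendsto_mult[OF c_lim LIMSEQ_ignore_initial_segment[where k = m]]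
    by (fastforce simp: down_to_zero_def)
  have nA': "dual_pair (p (k + m)) (- js k)
      \<in> eps_normals (c k * \<epsilon>' (k + m)) (x1 (k + m), y1 (k + m)) ?A" for k
    using eps_normals_scale[OF nA[of "k + m"] c(1)[of k]]
    by (simp add: dual_pair_scale js_def c(2))
  have nB': "dual_pair (js k) (- q (k + m))
      \<in> eps_normals (c k * \<epsilon>' (k + m)) (y2 (k + m), z2 (k + m)) ?B" for k
    using eps_normals_scale[OF nB[of "k + m"] c(1)[of k]]
    by (simp add: dual_pair_scale js_def c(2))
  have seq1: "coderiv_seq S1 \<Omega> UNIV x y (\<lambda>k. c k * \<epsilon>' (k + m)) (\<lambda>k. x1 (k + m)) (\<lambda>k. y1 (k + m))
      (\<lambda>k. p (k + m)) js"
    unfolding coderiv_seq_def using \<epsilon>'' lims' inA nA' Yall pJ by blast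
  have seq2: "coderiv_seq S2 UNIV \<Theta> y z (\<lambda>k. c k * \<epsilon>' (k + m)) (\<lambda>k. y2 (k + m)) (\<lambda>k. z2 (k + m))
      js (\<lambda>k. q (k + m))"
    unfolding coderiv_seq_def using \<epsilon>'' lims' inB nB' Yall qJ by blast
  show thesis
  proof (rule that)
    show "xs \<in> normal_coderiv S1 \<Omega> UNIV x y ((1 / a) *\<^sub>R l)"
      unfolding normal_coderiv_def using seq1 js weak_star_subseq[OF p shift] by blast
    show "(1 / a) *\<^sub>R l \<in> normal_coderiv S2 UNIV \<Theta> y z zs"
      unfolding normal_coderiv_def using seq2 js weak_star_subseq[OF q shift] by blast
    show "(1 / a) *\<^sub>R l \<in> mixed_coderiv S2 UNIV \<Theta> y z zs" if "zsk \<longlonglongrightarrow> zs"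
      unfolding mixed_coderiv_def
      using seq2 js LIMSEQ_ignore_initial_segment[OF qn[rule_format, OF that], of m] by blast
  qed
qed

section \<open>Composition with a strictly differentiable map\<close>

lemma has_strict_derivativeD:
  assumes "has_strict_derivative f D y" and e: "e > 0"
  obtains \<delta> where "\<delta> > 0"
    "\<And>v u. dist v y < \<delta> \<Longrightarrow> dist u y < \<delta> \<Longrightarrow> norm (f v - f u - blinfun_apply D (v - u)) \<le> e * norm (v - u)"
proof -
  let ?q = "\<lambda>(v, u). (f v - f u - blinfun_apply D (v - u)) /\<^sub>R norm (v - u)"
  have "\<forall>\<^sub>F p in at (y, y) within {(v, u). v \<noteq> u}. dist (?q p) 0 < e"
    using assms unfolding has_strict_derivative_def by (rule tendstoD)
  then obtain d where d: "d > 0"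
    "\<And>p. p \<in> {(v, u). v \<noteq> u} \<Longrightarrow> p \<noteq> (y, y) \<Longrightarrow> dist p (y, y) < d \<Longrightarrow> dist (?q p) 0 < e"
    unfolding eventually_at by blast
  show thesis
  proof (rule that[of "d / 2"])
    show "d / 2 > 0" using d(1) by simp
    fix v u assume vu: "dist v y < d / 2" "dist u y < d / 2"
    show "norm (f v - f u - blinfun_apply D (v - u)) \<le> e * norm (v - u)"
    proof (cases "v = u")
      case False
      have "dist (v, u) (y, y) < d"
        using norm_Pair_le[of "v - y" "u - y"] vu by (simp add: dist_norm)
      then have "dist (?q (v, u)) 0 < e" using False by (intro d(2)) auto
      then have "norm (f v - f u - blinfun_apply D (v - u)) / norm (v - u) < e"
        by (simp add: divide_inverse mult.commute)
      then show ?thesis using False by (simp add: divide_less_eq)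
    qed simp
  qed
qed

lemma eventual_diagonal:
  assumes "\<And>n. \<forall>\<^sub>F k in sequentially. P n (k::nat)"
  obtains s where "strict_mono s" "\<And>n::nat. P n (s n)"
proof -
  have "\<exists>N. \<forall>k\<ge>N. P n k" for n using assms[of n] by (simp add: eventually_sequentially)
  then obtain N where N: "\<And>n k. k \<ge> N n \<Longrightarrow> P n k" by metis
  show thesis
  proof (rule that[of "\<lambda>n. \<Sum>i\<le>n. Suc (N i)"])
    show "strict_mono (\<lambda>n. \<Sum>i\<le>n. Suc (N i))" by (simp add: strict_mono_Suc_iff)
    show "P n (\<Sum>i\<le>n. Suc (N i))" for n
    proof (rule N)
      have "Suc (N n) \<le> (\<Sum>i\<le>n. Suc (N i))" by (rule member_le_sum) auto
      then show "N n \<le> (\<Sum>i\<le>n. Suc (N i))" by simp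
    qed
  qed
qed

text \<open>
  The error from the linearisation is small only for \<open>k\<close> large depending on \<open>e\<close>, so this is an
  eventual statement for each fixed \<open>e\<close>; a diagonal subsequence combines the cases \<open>e \<longlonglongrightarrow> 0\<close>.
\<close>

lemma smooth_composition_normals:
  fixes S1 :: "'x::real_normed_vector \<Rightarrow> 'y::real_normed_vector set"
    and f :: "'y \<Rightarrow> 'z::real_normed_vector"
  assumes strict: "has_strict_derivative f D y" and e: "e > 0"
    and \<epsilon>: "\<And>k. \<epsilon> k > 0" "\<epsilon> \<longlonglongrightarrow> 0" and yk: "yk \<longlonglongrightarrow> y"
    and bound: "\<And>k. norm (zsk k) \<le> B"
    and normal: "\<And>k. dual_pair (xsk k) (- zsk k) \<in> eps_normals (\<epsilon> k) (xk k, f (yk k))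
      (gph (mrestrict (mcomp (\<lambda>y. {f y}) S1) \<Omega> UNIV))"
  shows "\<forall>\<^sub>F k in sequentially. dual_pair (xsk k) (- (zsk k o\<^sub>L D))
    \<in> eps_normals e (xk k, yk k) (gph (mrestrict S1 \<Omega> UNIV))"
proof -
  let ?C = "gph (mrestrict (mcomp (\<lambda>y. {f y}) S1) \<Omega> UNIV)"
  define C where "C = norm D + 2"
  have C: "C > 0" unfolding C_def using norm_ge_zero[of D] by linarith
  have "B \<ge> 0" using norm_ge_zero[of "zsk 0"] bound[of 0] by linarith
  define e1 where "e1 = min 1 (e / (2 * (B + 1)))"
  have e1: "e1 > 0" "e1 \<le> 1" using e \<open>B \<ge> 0\<close> by (auto simp: e1_def)
  have "B * e1 \<le> (B + 1) * e1" using e1 by simp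
  also have "\<dots> \<le> (B + 1) * (e / (2 * (B + 1)))"
    using \<open>B \<ge> 0\<close> by (intro mult_left_mono) (auto simp: e1_def)
  also have "\<dots> = e / 2" using \<open>B \<ge> 0\<close> by (simp add: field_simps)
  finally have Be: "B * e1 \<le> e / 2" .
  obtain \<delta> where \<delta>: "\<delta> > 0" and approx: "\<And>v u. dist v y < \<delta> \<Longrightarrow> dist u y < \<delta> \<Longrightarrow>
      norm (f v - f u - blinfun_apply D (v - u)) \<le> e1 * norm (v - u)"
    using has_strict_derivativeD[OF strict e1(1)] by blast
  have "\<forall>\<^sub>F k in sequentially. dist (yk k) y < \<delta> / 2"
    using yk \<delta> by (intro tendstoD) auto
  moreover have "\<forall>\<^sub>F k in sequentially. \<epsilon> k < e / (4 * C)"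
    using \<epsilon>(2) e C by (intro order_tendstoD(2)) auto
  ultimately show ?thesis
  proof eventually_elim
    case (elim k)
    obtain d where d: "d > 0" "\<And>u. u \<in> ?C \<Longrightarrow> dist u (xk k, f (yk k)) < d \<Longrightarrow>
        blinfun_apply (dual_pair (xsk k) (- zsk k)) (u - (xk k, f (yk k)))
          \<le> (\<epsilon> k + \<epsilon> k) * norm (u - (xk k, f (yk k)))"
      using normal[of k, unfolded eps_normals_iff, THEN spec, THEN mp, OF \<epsilon>(1)[of k]] by blast
    show ?case
    proof (rule eps_normalsI)
      show "min (\<delta> / 2) (d / C) > 0" using \<delta> d(1) C by simp
      fix u assume u: "u \<in> gph (mrestrict S1 \<Omega> UNIV)" "dist u (xk k, yk k) < min (\<delta> / 2) (d / C)"
      obtain v w where vw: "u = (v, w)" by (metis prod.collapse)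
      define n where "n = norm (u - (xk k, yk k))"
      have parts: "norm (v - xk k) \<le> n" "norm (w - yk k) \<le> n"
        using norm_fst_le[of "v - xk k" "w - yk k"] norm_snd_le[of "w - yk k" "v - xk k"]
        by (auto simp: n_def vw)
      have n: "n < \<delta> / 2" "n < d / C" using u(2) by (auto simp: n_def dist_norm)
      have near: "dist w y < \<delta>" "dist (yk k) y < \<delta>"
        using dist_triangle[of w y "yk k"] parts(2) n(1) elim(1) \<delta> by (auto simp: dist_norm)
      define r where "r = f w - f (yk k) - blinfun_apply D (w - yk k)"
      have r: "norm r \<le> e1 * n"
        using approx[OF near] parts(2) e1(1) unfolding r_def
        by (meson mult_left_mono order_trans less_imp_le)
      have f_eq: "f w - f (yk k) = blinfun_apply D (w - yk k) + r" by (simp add: r_def)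
      have "norm (blinfun_apply D (w - yk k)) \<le> norm D * n"
        using norm_blinfun[of D "w - yk k"] mult_left_mono[OF parts(2) norm_ge_zero[of D]] by linarith
      moreover have "norm r \<le> 1 * n"
        using r mult_right_mono[OF e1(2), of n] by (simp add: n_def)
      ultimately have "norm (f w - f (yk k)) \<le> (norm D + 1) * n"
        unfolding f_eq using norm_triangle_ineq[of "blinfun_apply D (w - yk k)" r]
        by (simp add: distrib_right)
      then have image: "norm ((v, f w) - (xk k, f (yk k))) \<le> C * n"
        using norm_Pair_le[of "v - xk k" "f w - f (yk k)"] parts(1) by (simp add: C_def algebra_simps)
      have "C * n < d" using n(2) C by (simp add: field_simps)
      moreover have "(v, f w) \<in> ?C"
        using u(1) by (auto simp: vw gph_def mrestrict_def mcomp_def split: if_splits)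
      ultimately have "blinfun_apply (xsk k) (v - xk k) - blinfun_apply (zsk k) (f w - f (yk k))
          \<le> 2 * \<epsilon> k * norm ((v, f w) - (xk k, f (yk k)))"
        using d(2)[of "(v, f w)"] image by (simp add: dist_norm blinfun.minus_left)
      also have "\<dots> \<le> 2 * \<epsilon> k * (C * n)"
        using image \<epsilon>(1)[of k] by (intro mult_left_mono) auto
      also have "\<dots> \<le> e / 2 * n"
      proof -
        have "2 * \<epsilon> k * C \<le> e / 2" using elim(2) C by (simp add: field_simps)
        then have "2 * \<epsilon> k * C * n \<le> e / 2 * n" by (rule mult_right_mono) (simp add: n_def)
        then show ?thesis by (simp add: mult.assoc)
      qed
      finally have main: "blinfun_apply (xsk k) (v - xk k)
          - blinfun_apply (zsk k) (blinfun_apply D (w - yk k)) \<le> e / 2 * n + blinfun_apply (zsk k) r"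
        unfolding f_eq by (simp add: blinfun.add_right)
      have "blinfun_apply (zsk k) r \<le> norm (zsk k) * norm r"
        using norm_blinfun[of "zsk k" r] by simp
      also have "\<dots> \<le> B * (e1 * n)"
        using bound r \<open>B \<ge> 0\<close> by (intro mult_mono) auto
      also have "\<dots> \<le> e / 2 * n"
        using mult_right_mono[OF Be, of n] by (simp add: n_def mult.assoc)
      finally have "blinfun_apply (xsk k) (v - xk k)
          - blinfun_apply (zsk k) (blinfun_apply D (w - yk k)) \<le> e * n"
        using main by simp
      then show "blinfun_apply (dual_pair (xsk k) (- (zsk k o\<^sub>L D))) (u - (xk k, yk k))
          \<le> e * norm (u - (xk k, yk k))"
        by (simp add: vw n_def blinfun.minus_left)
    qed
  qed
qed

lemma smooth_composition_rule:
  fixes S1 :: "'x::banach \<Rightarrow> 'y::banach set" and f :: "'y \<Rightarrow> 'z::banach"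
  assumes Y: "lur_reflexive TYPE('y)"
    and G_eq: "\<And>x z. G (x, z) = {y \<in> S1 x. z \<in> {f y}}"
    and isc: "inner_semicontinuous G (\<Omega> \<times> UNIV) (x, z) y"
    and strict: "has_strict_derivative f D y"
    and xs: "xs \<in> mixed_coderiv (mcomp (\<lambda>y. {f y}) S1) \<Omega> UNIV x z zs"
  shows "xs \<in> mixed_coderiv S1 \<Omega> UNIV x y (zs o\<^sub>L D)"
proof -
  let ?A = "gph (mrestrict S1 \<Omega> UNIV)"
  obtain \<epsilon> xk zk xsk zsk where seq: "coderiv_seq (mcomp (\<lambda>y. {f y}) S1) \<Omega> UNIV x z \<epsilon> xk zk xsk zsk"
    and xsk: "weak_star_tendsto xsk xs" and zsk: "zsk \<longlonglongrightarrow> zs"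
    using xs unfolding mixed_coderiv_def by blast
  have \<epsilon>: "\<And>k. \<epsilon> k > 0" "\<epsilon> \<longlonglongrightarrow> 0" and xk: "xk \<longlonglongrightarrow> x" and zk: "zk \<longlonglongrightarrow> z"
    and gphk: "\<And>k. (xk k, zk k) \<in> gph (mrestrict (mcomp (\<lambda>y. {f y}) S1) \<Omega> UNIV)"
    and normal: "\<And>k. dual_pair (xsk k) (- zsk k)
      \<in> eps_normals (\<epsilon> k) (xk k, zk k) (gph (mrestrict (mcomp (\<lambda>y. {f y}) S1) \<Omega> UNIV))"
    and pJ: "\<And>k. xsk k \<in> duality_image (contingent_cone (xk k) \<Omega>)"
    using seq by (auto simp: coderiv_seq_def down_to_zero_def)
  obtain yk where yk: "yk \<longlonglongrightarrow> y" "\<And>k. (xk k, yk k) \<in> ?A"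
    "\<And>k. (yk k, zk k) \<in> gph (mrestrict (\<lambda>y. {f y}) UNIV UNIV)"
    using intermediate_sequence[OF G_eq isc gphk xk zk] by blast
  have zf: "zk k = f (yk k)" for k using yk(3)[of k] by (simp add: gph_def mrestrict_def)
  obtain B where B: "\<And>k. norm (zsk k) \<le> B"
    using convergent_imp_Bseq[OF convergentI[OF zsk]] by (auto simp: Bseq_def)
  define e where "e n = inverse (real (Suc n))" for n
  have e: "down_to_zero e"
    unfolding down_to_zero_def e_def using LIMSEQ_inverse_real_of_nat by auto
  have "\<forall>\<^sub>F k in sequentially. dual_pair (xsk k) (- (zsk k o\<^sub>L D)) \<in> eps_normals (e n) (xk k, yk k) ?A" for n
    by (rule smooth_composition_normals[OF strict _ \<epsilon> yk(1) B normal[unfolded zf]]) (simp add: e_def)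
  then obtain s where s: "strict_mono s"
    "\<And>n. dual_pair (xsk (s n)) (- (zsk (s n) o\<^sub>L D)) \<in> eps_normals (e n) (xk (s n), yk (s n)) ?A"
    using eventual_diagonal[of "\<lambda>n k. dual_pair (xsk k) (- (zsk k o\<^sub>L D)) \<in> eps_normals (e n) (xk k, yk k) ?A"]
    by blast
  have Yall: "g \<in> duality_image (contingent_cone v UNIV)" for g and v :: 'y
    using duality_image_UNIV[of v] Y by (simp add: lur_reflexive_def)
  have "(\<lambda>n. xk (s n)) \<longlonglongrightarrow> x" "(\<lambda>n. yk (s n)) \<longlonglongrightarrow> y"
    using LIMSEQ_subseq_LIMSEQ[OF xk s(1)] LIMSEQ_subseq_LIMSEQ[OF yk(1) s(1)] by (auto simp: o_def)
  then have "coderiv_seq S1 \<Omega> UNIV x y e (\<lambda>n. xk (s n)) (\<lambda>n. yk (s n)) (\<lambda>n. xsk (s n)) (\<lambda>n. zsk (s n) o\<^sub>L D)"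
    unfolding coderiv_seq_def using e yk(2) s(2) pJ Yall by blast
  moreover have "(\<lambda>n. zsk (s n) o\<^sub>L D) \<longlonglongrightarrow> (zs o\<^sub>L D)"
    using LIMSEQ_subseq_LIMSEQ[OF zsk s(1)]
    by (intro bounded_bilinear.tendsto[OF bounded_bilinear_blinfun_compose] tendsto_const) (simp add: o_def)
  ultimately show ?thesis
    unfolding mixed_coderiv_def using weak_star_subseq[OF xsk s(1)] by blast
qed

theorem theorem4p2:
  fixes S1 :: "'x::banach \<Rightarrow> 'y::banach set" and S2 :: "'y \<Rightarrow> 'z::banach set"
    and \<Omega> :: "'x set" and \<Theta> :: "'z set"
    and S :: "'x \<Rightarrow> 'z set" and G :: "'x \<times> 'z \<Rightarrow> 'y set"
    and xbar :: 'x and ybar :: 'y and zbar :: 'z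
  assumes "lur_reflexive TYPE('x)" and "lur_reflexive TYPE('y)" and "lur_reflexive TYPE('z)"
    and "closed \<Omega>" and "convex \<Omega>" and "closed \<Theta>" and "convex \<Theta>"
    and S_eq: "S = mcomp S2 S1"
    and G_eq: "\<And>x z. G (x, z) = {y \<in> S1 x. z \<in> S2 y}"
    and "(xbar, zbar) \<in> gph (mrestrict S \<Omega> \<Theta>)"
    and "ybar \<in> G (xbar, zbar)"
    and "closed_around (gph (mrestrict S1 \<Omega> UNIV)) (xbar, ybar)"
    and "closed_around (gph (mrestrict S2 UNIV \<Theta>)) (ybar, zbar)"
    and "inner_semicontinuous G (\<Omega> \<times> \<Theta>) (xbar, zbar) ybar"
  shows
    "((mirror_PSNC S1 \<Omega> UNIV xbar ybar \<or> PSNC S2 UNIV \<Theta> ybar zbar) \<and>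
      mker (mirror_coderiv S1 \<Omega> UNIV xbar ybar) \<inter> mixed_coderiv S2 UNIV \<Theta> ybar zbar 0 = {0}
      \<longrightarrow>
      (\<forall>zs. mixed_coderiv S \<Omega> \<Theta> xbar zbar zs
              \<subseteq> mcomp (normal_coderiv S1 \<Omega> UNIV xbar ybar) (mixed_coderiv S2 UNIV \<Theta> ybar zbar) zs \<and>
            normal_coderiv S \<Omega> \<Theta> xbar zbar zs
              \<subseteq> mcomp (normal_coderiv S1 \<Omega> UNIV xbar ybar) (normal_coderiv S2 UNIV \<Theta> ybar zbar) zs))
     \<and>
     (\<forall>(f :: 'y \<Rightarrow> 'z) (Df :: 'y \<Rightarrow>\<^sub>L 'z).
        \<Theta> = UNIV \<and> S2 = (\<lambda>y. {f y}) \<and> has_strict_derivative f Df ybar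
        \<longrightarrow>
        (\<forall>zs. mixed_coderiv S \<Omega> UNIV xbar zbar zs
                \<subseteq> mixed_coderiv S1 \<Omega> UNIV xbar ybar (zs o\<^sub>L Df)))"
proof (intro conjI impI allI)
  fix zs
  assume hyp: "(mirror_PSNC S1 \<Omega> UNIV xbar ybar \<or> PSNC S2 UNIV \<Theta> ybar zbar) \<and>
      mker (mirror_coderiv S1 \<Omega> UNIV xbar ybar) \<inter> mixed_coderiv S2 UNIV \<Theta> ybar zbar 0 = {0}"
  note rule = composition_rule[OF assms(1-3) assms(5,7) G_eq assms(12-14) hyp[THEN conjunct1] hyp[THEN conjunct2]]
  show "mixed_coderiv S \<Omega> \<Theta> xbar zbar zs
      \<subseteq> mcomp (normal_coderiv S1 \<Omega> UNIV xbar ybar) (mixed_coderiv S2 UNIV \<Theta> ybar zbar) zs"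
  proof
    fix xs assume "xs \<in> mixed_coderiv S \<Omega> \<Theta> xbar zbar zs"
    then obtain \<epsilon> xk zk xsk zsk where seq: "coderiv_seq (mcomp S2 S1) \<Omega> \<Theta> xbar zbar \<epsilon> xk zk xsk zsk"
      and xsk: "weak_star_tendsto xsk xs" and zsk: "zsk \<longlonglongrightarrow> zs"
      unfolding mixed_coderiv_def S_eq by blast
    have weak: "weak_star_tendsto zsk zs"
      unfolding weak_star_tendsto_def using zsk by (auto intro!: tendsto_intros)
    show "xs \<in> mcomp (normal_coderiv S1 \<Omega> UNIV xbar ybar) (mixed_coderiv S2 UNIV \<Theta> ybar zbar) zs"
      using rule[OF seq xsk weak] zsk unfolding mcomp_def by blast
  qed
  show "normal_coderiv S \<Omega> \<Theta> xbar zbar zs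
      \<subseteq> mcomp (normal_coderiv S1 \<Omega> UNIV xbar ybar) (normal_coderiv S2 UNIV \<Theta> ybar zbar) zs"
  proof
    fix xs assume "xs \<in> normal_coderiv S \<Omega> \<Theta> xbar zbar zs"
    then obtain \<epsilon> xk zk xsk zsk where seq: "coderiv_seq (mcomp S2 S1) \<Omega> \<Theta> xbar zbar \<epsilon> xk zk xsk zsk"
      and weak: "weak_star_tendsto xsk xs" "weak_star_tendsto zsk zs"
      unfolding normal_coderiv_def S_eq by blast
    show "xs \<in> mcomp (normal_coderiv S1 \<Omega> UNIV xbar ybar) (normal_coderiv S2 UNIV \<Theta> ybar zbar) zs"
      using rule[OF seq weak] unfolding mcomp_def by blast
  qed
next
  fix f :: "'y \<Rightarrow> 'z" and Df :: "'y \<Rightarrow>\<^sub>L 'z" and zs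
  assume hyp: "\<Theta> = UNIV \<and> S2 = (\<lambda>y. {f y}) \<and> has_strict_derivative f Df ybar"
  then have S2: "S2 = (\<lambda>y. {f y})" and \<Theta>: "\<Theta> = UNIV" and strict: "has_strict_derivative f Df ybar"
    by auto
  show "mixed_coderiv S \<Omega> UNIV xbar zbar zs \<subseteq> mixed_coderiv S1 \<Omega> UNIV xbar ybar (zs o\<^sub>L Df)"
    using smooth_composition_rule[OF assms(2) G_eq[unfolded S2] assms(14)[unfolded \<Theta>] strict]
    unfolding S_eq S2 by blast
qed

end
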